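(* Consider a wireless network in which agents exchange information using the over-the-air computation (OTA-C) protocol described in the context, and let the channel assumptions (i)–(vii) and the network assumptions (N1)–(N2) in the context hold. Then the resulting information-exchange model $\check{\mathsf K}_i(\psi)=(\check P_i+\check W_i)\psi+\check n_i$ satisfies, for every $i\in\mathbb{N}$: 1. there exist $0<\epsilon_0\le1$ and $0\le\delta_0<\infty$ such that $\check P_i$ is an $(\epsilon_0,\delta_0)$-random consensus matrix; 2. $\mathbb{E}[\check W_i]=0$ and $\mathbb{E}[\check n_i]=0$; 3. $\mathbb{E}[\check P_i^T\check W_i]=0$ and $\mathbb{E}[\check P_i^T\check n_i]=0$; 4. there exist $0\le a_0,b_0,c_0<\infty$ such that $\|\mathbb{E}[\check W_i^T\check W_i]\|_2\le a_0$, $\mathbb{E}[\check n_i^T\check n_i]\le b_0$ and $\|\mathbb{E}[\check W_i^T\check n_i]\|_2\le c_0$.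
   Context: **Conventions.** $\mathcal{A}=\{1,\dots,N\}$ is the set of agents; $\|\cdot\|$ is the Euclidean norm, $\|\cdot\|_2$ the spectral norm, $\rho(\cdot)$ the spectral radius. $\mathcal{C}=\{[h_1^T,\dots,h_N^T]^T\in\mathbb{R}^{MN}\mid h_1=\dots=h_N\in\mathbb{R}^M\}$ and $\mathcal{C}^\perp$ is its orthogonal complement. **$(\epsilon,\delta)$-random consensus matrix** ($0<\epsilon\le1$, $0\le\delta<\infty$): a random matrix $P\in\mathbb{R}^{MN\times MN}$ such that, with $\overline P:=\mathbb{E}[P]$: (1) $Pv=v$ for every $v\in\mathcal{C}$ a.s.; (2) $\overline P$ is entrywise nonnegative; (3) $\max_{\|x\|=1,\,x\in\mathcal{C}^\perp}x^T\overline Px\le1-\epsilon$; (4) $\rho(\overline P)=\|\overline P\|_2$; (5) $1\le\|\mathbb{E}[P^TP]\|_2\le1+\delta$. **Network.** At time $i\in\mathbb{N}$ the network is a random weighted graph $\mathcal{G}_i=(\mathcal{A},\mathcal{E}_i)$, $\mathcal{E}_i\subseteq\mathcal{A}\times\mathcal{A}$, where $(j,r)\in\mathcal{E}_i$ means $j$ can transmit to $r$; $\mathcal{A}_r=\{j\mid(j,r)\in\mathcal{E}_i\}$ are the neighbors of $r$. Edge weights are the random variables $\nu_{jr,i}^{(m)}$ below; the expected graph $\overline{\mathcal{G}}_i$ has as weights the expectations of these. **Channel.** One scalar OTA-C run uses a wireless multiple access channel $2B$ times ($B\ge1$): if agents $j$ send complex symbols $s_j(b)$, agent $r$ receives $q_r(b)=\sum_{j\in\mathcal{A}_r}\xi_{jr}(b)s_j(b)+w_r(b)$,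 $b=1,\dots,2B$, where the complex random variables $\xi_{jr}(b)$ (fading) and $w_r(b)$ (noise) are realizations of $\xi_{jr}$ and $w_r$. Channel assumptions: for all agents $r,l\in\mathcal{A}$, $j\in\mathcal{A}_r$, $k\in\mathcal{A}_l$: (i) $\mathbb{E}[w_r]=0$; (ii) $\mathbb{E}[|w_r|^2]<\infty$; (iii) $\mathbb{E}[|w_r|^2|w_l|^2]<\infty$; (iv) $\mathbb{E}[|\xi_{jr}|^2]<\infty$; (v) $\mathbb{E}[|\xi_{jr}|^2|\xi_{lk}|^2]<\infty$; (vi) $\xi_{jr}$ and $w_l$ are independent; (vii) $\xi_{jr}(b)=\xi_{jr}(b+1)$ for every odd $b$. **Scalar OTA-C run.** Each agent $j$ has an input $\lambda_j\in[\delta_{\min},\delta_{\max}]$, $\delta_{\min}<\delta_{\max}$, $\Delta:=\delta_{\max}-\delta_{\min}$. With $g_j(x)=(P_j/\Delta)(x-\delta_{\min})$, $P_j>0$, it sends $s_j(b)=\sqrt{g_j(\lambda_j)}\,U_j(b)$ for odd $b$ and $s_j(b)=\sqrt{g_j(\delta_{\max})}\,U_j(b)$ for even $b$, where the $U_j(b)$ are i.i.d. complex random variables, sampled by the transmitters, with $\mathbb{E}[U_j(b)]=0$ and $|U_j(b)|=1$. With $y_r=[q_r(1),q_r(3),\dots,q_r(2B-1)]^T$, $y'_r=[q_r(2),q_r(4),\dots,q_r(2B)]^T$ and noise power $m_r:=\mathbb{E}[|w_r|^2]$, agent $r$ computes $\hat v'_r=B^{-1}\|y'_r\|^2-m_r$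 and $\hat v_r=\Delta(B^{-1}\|y_r\|^2-m_r)+\delta_{\min}\hat v'_r$. Put $\nu_{jr}:=(P_j/B)\sum_{b=1}^B|\xi_{jr}(2b-1)|^2$ and $\eta_r:=\hat v_r-\sum_{j\in\mathcal{A}_r}\nu_{jr}\lambda_j$, $\eta'_r:=\hat v'_r-\sum_{j\in\mathcal{A}_r}\nu_{jr}$. **Vector protocol.** At time $i$, agent $r$ holds $\lambda_{r,i}\in[\delta_{\min},\delta_{\max}]^M$; one scalar run is performed for each coordinate $m=1,\dots,M$, producing weights $\nu^{(m)}_{jr,i}$ and errors $\eta_{r,i}^{(m)},\eta_{r,i}'^{(m)}$. Let $Z_{jr,i}=\mathrm{Diag}(\nu^{(1)}_{jr,i},\dots,\nu^{(M)}_{jr,i})$, $\tilde n_{r,i}=[\eta_{r,i}^{(1)},\dots,\eta_{r,i}^{(M)}]^T$, $\acute n_{r,i}=[\eta_{r,i}'^{(1)},\dots,\eta_{r,i}'^{(M)}]^T$, so agent $r$ obtains $\hat v_{r,i}=\sum_{j\in\mathcal{A}_r}Z_{jr,i}\lambda_{j,i}+\tilde n_{r,i}$ and $\hat v'_{r,i}=\sum_{j\in\mathcal{A}_r}Z_{jr,i}\mathbf{1}_M+\acute n_{r,i}$. It updates $h_{r,i+1}=(\mathbf{1}_M-\beta_i\gamma_i\hat v'_{r,i})\odot\lambda_{r,i}+\beta_i\gamma_i\hat v_{r,i}$ ($\odot$ entrywise product), where $\beta_i\in(0,1]$ and $0<\gamma_i\le\big(\max_{r\in\mathcal{A}}\sum_{j\in\mathcal{A}_r}\mathbb{E}[\nu^{(m)}_{jr,i}]\big)^{-1}<\infty$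 for every $m$. Stacking over $r$, this reads $\check\psi_{i+1}=(1-\beta_i)\check\lambda_i+\beta_i\check{\mathsf K}_i(\check\lambda_i)$, where $\check P_i$ is the $N\times N$ block matrix with $M\times M$ blocks $$[\check P_i]_{(p,q)}=\begin{cases}I_M-\gamma_i\sum_{j\in\mathcal{A}_p}Z_{jp,i}&p=q,\\ \gamma_iZ_{qp,i}&(p,q)\in\mathcal{E}_i,\\0&\text{otherwise,}\end{cases}$$ $\check W_i=-\gamma_i\,\mathrm{Diag}\big([\acute n_{1,i}^T,\dots,\acute n_{N,i}^T]^T\big)$ and $\check n_i=\gamma_i[\tilde n_{1,i}^T,\dots,\tilde n_{N,i}^T]^T$. **Network assumptions**, for every $i\in\mathbb{N}$: (N1) the expected graph $\overline{\mathcal{G}}_i$ is connected; (N2) its edge weights are reciprocal, $\mathbb{E}[\nu_{jr,i}^{(m)}]=\mathbb{E}[\nu_{rj,i}^{(m)}]$ for all $(j,r)\in\mathcal{E}_i$ (and all $m$), so $\overline{\mathcal{G}}_i$ is undirected.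
   Formalization: Self-loops are excluded: no agent is its own neighbor, since otherwise the displayed matrix does not fix consensus vectors. The transmitted random symbols are taken independent of fading, noise and inputs, and (vi) is taken to hold across all channel uses of a run. *)

theory Defs
  imports "HOL-Probability.Probability"
begin

section \<open>Random consensus matrices\<close>

text \<open>
  Stacked vectors \<open>[h\<^sub>1\<^sup>T, \<dots>, h\<^sub>N\<^sup>T]\<^sup>T\<close> are indexed by pairs (agent, coordinate), so the space of
  dimension \<open>MN\<close> is \<^typ>\<open>real^('n \<times> 'm)\<close> with \<open>N = CARD('n)\<close> and \<open>M = CARD('m)\<close>.
\<close>

definition stack :: "('n::finite \<Rightarrow> real^'m::finite) \<Rightarrow> real^('n \<times> 'm)" where
  "stack h = (\<chi> a. h (fst a) $ snd a)"

definition block_matrix :: "('n::finite \<Rightarrow> 'n \<Rightarrow> real^'m::finite^'m) \<Rightarrow> real^('n \<times> 'm)^('n \<times> 'm)" where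
  "block_matrix F = (\<chi> a b. F (fst a) (fst b) $ snd a $ snd b)"

definition Diag :: "real^'k::finite \<Rightarrow> real^'k^'k" where
  "Diag v = (\<chi> i j. if i = j then v $ i else 0)"

definition consensus_subspace :: "(real^('n::finite \<times> 'm::finite)) set" where
  "consensus_subspace = {stack h | h. \<forall>r s. h r = h s}"

definition spectral_norm :: "real^'k::finite^'k \<Rightarrow> real" where
  "spectral_norm A = onorm ((*v) A)"

definition spectral_radius :: "real^'k::finite^'k \<Rightarrow> real" where
  "spectral_radius A =
     Max {cmod z | z. \<exists>v. v \<noteq> 0 \<and> map_matrix complex_of_real A *v v = z *s v}"

text \<open>
  The Bochner integral of a non-integrable function is 0 by convention.  Existence of the
  expectations is therefore required explicitly here and in the main statement.
\<close>

definition random_consensus_matrix ::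
  "'w measure \<Rightarrow> real \<Rightarrow> real \<Rightarrow> ('w \<Rightarrow> real^('n::finite \<times> 'm::finite)^('n \<times> 'm)) \<Rightarrow> bool" where
  "random_consensus_matrix M \<epsilon> \<delta> P \<longleftrightarrow>
     0 < \<epsilon> \<and> \<epsilon> \<le> 1 \<and> 0 \<le> \<delta> \<and>
     integrable M P \<and> integrable M (\<lambda>\<omega>. transpose (P \<omega>) ** P \<omega>) \<and>
     (let Pbar = integral\<^sup>L M P in
        (AE \<omega> in M. \<forall>v \<in> consensus_subspace. P \<omega> *v v = v) \<and>
        (\<forall>a b. 0 \<le> Pbar $ a $ b) \<and>
        (\<forall>x \<in> orthogonal_comp consensus_subspace. norm x = 1 \<longrightarrow> x \<bullet> (Pbar *v x) \<le> 1 - \<epsilon>) \<and>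
        spectral_radius Pbar = spectral_norm Pbar \<and>
        1 \<le> spectral_norm (integral\<^sup>L M (\<lambda>\<omega>. transpose (P \<omega>) ** P \<omega>)) \<and>
        spectral_norm (integral\<^sup>L M (\<lambda>\<omega>. transpose (P \<omega>) ** P \<omega>)) \<le> 1 + \<delta>)"


section \<open>The over-the-air protocol\<close>

text \<open>
  The arguments \<open>i\<close> and \<open>m\<close> (time and coordinate) of the channel fields select one scalar run.
  \<open>fading i m j r\<close> and \<open>noise i m r\<close> are the variables \<open>\<xi>\<^sub>j\<^sub>r\<close> and \<open>w\<^sub>r\<close> of that run; their
  realizations in channel use \<open>b \<in> {1..2B}\<close>, \<open>B\<close> being \<open>half_uses\<close>, are \<open>fading_at i m j r b\<close> and
  \<open>noise_at i m r b\<close>.  \<open>tx_code i m j b\<close> is the sequence \<open>U\<^sub>j(b)\<close>.  The held vectors \<open>\<lambda>\<^sub>r\<^sub>,\<^sub>i\<close>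
  (\<open>state i r\<close>) may be random, since they may depend on earlier runs.
\<close>

record ('w, 'n, 'm) ota_network =
  edges :: "nat \<Rightarrow> ('n \<times> 'n) set"
  half_uses :: nat
  dmin :: real
  dmax :: real
  tx_power :: "'n \<Rightarrow> real"
  fading :: "nat \<Rightarrow> 'm \<Rightarrow> 'n \<Rightarrow> 'n \<Rightarrow> 'w \<Rightarrow> complex"
  noise :: "nat \<Rightarrow> 'm \<Rightarrow> 'n \<Rightarrow> 'w \<Rightarrow> complex"
  fading_at :: "nat \<Rightarrow> 'm \<Rightarrow> 'n \<Rightarrow> 'n \<Rightarrow> nat \<Rightarrow> 'w \<Rightarrow> complex"
  noise_at :: "nat \<Rightarrow> 'm \<Rightarrow> 'n \<Rightarrow> nat \<Rightarrow> 'w \<Rightarrow> complex"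
  tx_code :: "nat \<Rightarrow> 'm \<Rightarrow> 'n \<Rightarrow> nat \<Rightarrow> 'w \<Rightarrow> complex"
  state :: "nat \<Rightarrow> 'n \<Rightarrow> 'w \<Rightarrow> real^'m::finite"
  beta :: "nat \<Rightarrow> real"
  gamma :: "nat \<Rightarrow> real"

type_synonym ('w, 'n, 'm) network = "('w, 'n, 'm) ota_network"

definition nbrs :: "('w, 'n, 'm::finite) network \<Rightarrow> nat \<Rightarrow> 'n \<Rightarrow> 'n set" where
  "nbrs net i r = {j. (j, r) \<in> edges net i}"

definition uses :: "('w, 'n, 'm::finite) network \<Rightarrow> nat set" where
  "uses net = {1..2 * half_uses net}"


subsection \<open>One scalar run\<close>

definition range_width :: "('w, 'n, 'm::finite) network \<Rightarrow> real" where
  "range_width net = dmax net - dmin net"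

definition pre_scale :: "('w, 'n, 'm::finite) network \<Rightarrow> 'n \<Rightarrow> real \<Rightarrow> real" where
  "pre_scale net j x = tx_power net j / range_width net * (x - dmin net)"

definition sent ::
  "('w, 'n, 'm::finite) network \<Rightarrow> nat \<Rightarrow> 'm \<Rightarrow> 'n \<Rightarrow> nat \<Rightarrow> 'w \<Rightarrow> complex" where
  "sent net i m j b \<omega> =
     complex_of_real (sqrt (pre_scale net j (if odd b then state net i j \<omega> $ m else dmax net)))
       * tx_code net i m j b \<omega>"

definition received ::
  "('w, 'n, 'm::finite) network \<Rightarrow> nat \<Rightarrow> 'm \<Rightarrow> 'n \<Rightarrow> nat \<Rightarrow> 'w \<Rightarrow> complex" where
  "received net i m r b \<omega> =
     (\<Sum>j\<in>nbrs net i r. fading_at net i m j r b \<omega> * sent net i m j b \<omega>) + noise_at net i m r b \<omega>"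

definition noise_power :: "'w measure \<Rightarrow> ('w, 'n, 'm::finite) network \<Rightarrow> nat \<Rightarrow> 'm \<Rightarrow> 'n \<Rightarrow> real" where
  "noise_power M net i m r = integral\<^sup>L M (\<lambda>\<omega>. (cmod (noise net i m r \<omega>))\<^sup>2)"

definition odd_energy ::
  "('w, 'n, 'm::finite) network \<Rightarrow> nat \<Rightarrow> 'm \<Rightarrow> 'n \<Rightarrow> 'w \<Rightarrow> real" where
  "odd_energy net i m r \<omega> = (\<Sum>b=1..half_uses net. (cmod (received net i m r (2 * b - 1) \<omega>))\<^sup>2)"

definition even_energy ::
  "('w, 'n, 'm::finite) network \<Rightarrow> nat \<Rightarrow> 'm \<Rightarrow> 'n \<Rightarrow> 'w \<Rightarrow> real" where
  "even_energy net i m r \<omega> = (\<Sum>b=1..half_uses net. (cmod (received net i m r (2 * b) \<omega>))\<^sup>2)"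

definition v_hat' ::
  "'w measure \<Rightarrow> ('w, 'n, 'm::finite) network \<Rightarrow> nat \<Rightarrow> 'm \<Rightarrow> 'n \<Rightarrow> 'w \<Rightarrow> real" where
  "v_hat' M net i m r \<omega> = even_energy net i m r \<omega> / real (half_uses net) - noise_power M net i m r"

definition v_hat ::
  "'w measure \<Rightarrow> ('w, 'n, 'm::finite) network \<Rightarrow> nat \<Rightarrow> 'm \<Rightarrow> 'n \<Rightarrow> 'w \<Rightarrow> real" where
  "v_hat M net i m r \<omega> =
     range_width net * (odd_energy net i m r \<omega> / real (half_uses net) - noise_power M net i m r)
       + dmin net * v_hat' M net i m r \<omega>"

text \<open>\<open>\<nu>\<^sub>j\<^sub>r\<close> is defined for edges only; a non-edge gets weight 0.\<close>

definition weight ::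
  "('w, 'n, 'm::finite) network \<Rightarrow> nat \<Rightarrow> 'm \<Rightarrow> 'n \<Rightarrow> 'n \<Rightarrow> 'w \<Rightarrow> real" where
  "weight net i m j r \<omega> =
     (if (j, r) \<in> edges net i
      then tx_power net j / real (half_uses net)
             * (\<Sum>b=1..half_uses net. (cmod (fading_at net i m j r (2 * b - 1) \<omega>))\<^sup>2)
      else 0)"

definition err ::
  "'w measure \<Rightarrow> ('w, 'n, 'm::finite) network \<Rightarrow> nat \<Rightarrow> 'm \<Rightarrow> 'n \<Rightarrow> 'w \<Rightarrow> real" where
  "err M net i m r \<omega> =
     v_hat M net i m r \<omega> - (\<Sum>j\<in>nbrs net i r. weight net i m j r \<omega> * state net i j \<omega> $ m)"

definition err' ::
  "'w measure \<Rightarrow> ('w, 'n, 'm::finite) network \<Rightarrow> nat \<Rightarrow> 'm \<Rightarrow> 'n \<Rightarrow> 'w \<Rightarrow> real" where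
  "err' M net i m r \<omega> = v_hat' M net i m r \<omega> - (\<Sum>j\<in>nbrs net i r. weight net i m j r \<omega>)"


subsection \<open>The vector protocol and its information-exchange model\<close>

definition Z_mat :: "('w, 'n, 'm::finite) network \<Rightarrow> nat \<Rightarrow> 'n \<Rightarrow> 'n \<Rightarrow> 'w \<Rightarrow> real^'m^'m" where
  "Z_mat net i j r \<omega> = Diag (\<chi> m. weight net i m j r \<omega>)"

definition n_tilde :: "'w measure \<Rightarrow> ('w, 'n, 'm::finite) network \<Rightarrow> nat \<Rightarrow> 'n \<Rightarrow> 'w \<Rightarrow> real^'m" where
  "n_tilde M net i r \<omega> = (\<chi> m. err M net i m r \<omega>)"

definition n_acute :: "'w measure \<Rightarrow> ('w, 'n, 'm::finite) network \<Rightarrow> nat \<Rightarrow> 'n \<Rightarrow> 'w \<Rightarrow> real^'m" where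
  "n_acute M net i r \<omega> = (\<chi> m. err' M net i m r \<omega>)"

definition P_check ::
  "('w, 'n::finite, 'm::finite) network \<Rightarrow> nat \<Rightarrow> 'w \<Rightarrow> real^('n \<times> 'm)^('n \<times> 'm)" where
  "P_check net i \<omega> = block_matrix (\<lambda>p q.
     if p = q then mat 1 - gamma net i *\<^sub>R (\<Sum>j\<in>nbrs net i p. Z_mat net i j p \<omega>)
     else if (p, q) \<in> edges net i then gamma net i *\<^sub>R Z_mat net i q p \<omega>
     else 0)"

definition W_check ::
  "'w measure \<Rightarrow> ('w, 'n::finite, 'm::finite) network \<Rightarrow> nat \<Rightarrow> 'w \<Rightarrow> real^('n \<times> 'm)^('n \<times> 'm)" where
  "W_check M net i \<omega> = - (gamma net i *\<^sub>R Diag (stack (\<lambda>r. n_acute M net i r \<omega>)))"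

definition n_check ::
  "'w measure \<Rightarrow> ('w, 'n::finite, 'm::finite) network \<Rightarrow> nat \<Rightarrow> 'w \<Rightarrow> real^('n \<times> 'm)" where
  "n_check M net i \<omega> = gamma net i *\<^sub>R stack (\<lambda>r. n_tilde M net i r \<omega>)"

definition K_check ::
  "'w measure \<Rightarrow> ('w, 'n::finite, 'm::finite) network \<Rightarrow> nat \<Rightarrow> 'w \<Rightarrow> real^('n \<times> 'm) \<Rightarrow> real^('n \<times> 'm)"
  where
  "K_check M net i \<omega> \<psi> = (P_check net i \<omega> + W_check M net i \<omega>) *v \<psi> + n_check M net i \<omega>"

text \<open>The products of two vectors are entrywise.\<close>

definition h_next ::
  "'w measure \<Rightarrow> ('w, 'n, 'm::finite) network \<Rightarrow> nat \<Rightarrow> 'n \<Rightarrow> 'w \<Rightarrow> real^'m" where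
  "h_next M net i r \<omega> =
     (1 - (beta net i * gamma net i) *\<^sub>R (\<chi> m. v_hat' M net i m r \<omega>)) * state net i r \<omega>
       + (beta net i * gamma net i) *\<^sub>R (\<chi> m. v_hat M net i m r \<omega>)"


section \<open>Assumptions\<close>

definition preimages :: "'w measure \<Rightarrow> ('k \<Rightarrow> 'w \<Rightarrow> 'b::topological_space) \<Rightarrow> 'k set \<Rightarrow> 'w set set" where
  "preimages M X I = {X k -` A \<inter> space M | k A. k \<in> I \<and> A \<in> sets borel}"

definition realizations ::
  "'w measure \<Rightarrow> ('w \<Rightarrow> complex) \<Rightarrow> (nat \<Rightarrow> 'w \<Rightarrow> complex) \<Rightarrow> nat set \<Rightarrow> bool" where
  "realizations M X Y I \<longleftrightarrow> X \<in> borel_measurable M \<and>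
     (\<forall>b\<in>I. Y b \<in> borel_measurable M \<and> distr M borel (Y b) = distr M borel X)"

text \<open>
  The first index of a fading variable is the transmitter, also in the mixed moments.
  Independence of \<open>\<xi>\<^sub>j\<^sub>r\<close> and \<open>w\<^sub>l\<close> refers to their realizations: \<open>\<xi>\<^sub>j\<^sub>r(b)\<close> and \<open>w\<^sub>l(b')\<close> are
  independent for any two channel uses of a run.  Independence over different channel uses is
  imposed neither within the fading nor within the noise.
\<close>

definition channel_assumptions :: "'w measure \<Rightarrow> ('w, 'n, 'm::finite) network \<Rightarrow> bool" where
  "channel_assumptions M net \<longleftrightarrow> (\<forall>i m.
     (\<forall>r. realizations M (noise net i m r) (noise_at net i m r) (uses net)) \<and>
     (\<forall>r. \<forall>j\<in>nbrs net i r. realizations M (fading net i m j r) (fading_at net i m j r) (uses net)) \<and>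
     (\<forall>r. has_bochner_integral M (noise net i m r) 0) \<and>
     (\<forall>r. integrable M (\<lambda>\<omega>. (cmod (noise net i m r \<omega>))\<^sup>2)) \<and>
     (\<forall>r l. integrable M (\<lambda>\<omega>. (cmod (noise net i m r \<omega>))\<^sup>2 * (cmod (noise net i m l \<omega>))\<^sup>2)) \<and>
     (\<forall>r. \<forall>j\<in>nbrs net i r. integrable M (\<lambda>\<omega>. (cmod (fading net i m j r \<omega>))\<^sup>2)) \<and>
     (\<forall>r l. \<forall>j\<in>nbrs net i r. \<forall>k\<in>nbrs net i l.
        integrable M (\<lambda>\<omega>. (cmod (fading net i m j r \<omega>))\<^sup>2 * (cmod (fading net i m k l \<omega>))\<^sup>2)) \<and>
     (\<forall>r l. \<forall>j\<in>nbrs net i r. \<forall>b\<in>uses net. \<forall>b'\<in>uses net.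
        prob_space.indep_var M borel (fading_at net i m j r b) borel (noise_at net i m l b')) \<and>
     (\<forall>r. \<forall>j\<in>nbrs net i r. \<forall>b\<in>uses net. odd b \<longrightarrow>
        (AE \<omega> in M. fading_at net i m j r b \<omega> = fading_at net i m j r (b + 1) \<omega>)))"

text \<open>
  The transmitters sample \<open>U\<^sub>j(b)\<close> themselves, independently of the channel and of the values they
  transmit: the last condition says that the \<open>\<sigma>\<close>-algebra of the code sequences of a run is
  independent of the one generated by the fading, the noise and the inputs of that run.
\<close>

definition code_assumptions :: "'w measure \<Rightarrow> ('w, 'n, 'm::finite) network \<Rightarrow> bool" where
  "code_assumptions M net \<longleftrightarrow> (\<forall>i m.
     prob_space.indep_vars M (\<lambda>_. borel) (\<lambda>(j, b). tx_code net i m j b) (UNIV \<times> uses net) \<and>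
     (\<forall>j k. \<forall>b\<in>uses net. \<forall>b'\<in>uses net.
        distr M borel (tx_code net i m j b) = distr M borel (tx_code net i m k b')) \<and>
     (\<forall>j. \<forall>b\<in>uses net. has_bochner_integral M (tx_code net i m j b) 0 \<and>
        (AE \<omega> in M. cmod (tx_code net i m j b \<omega>) = 1)) \<and>
     prob_space.indep_set M
       (sigma_sets (space M) (preimages M (\<lambda>(j, b). tx_code net i m j b) (UNIV \<times> uses net)))
       (sigma_sets (space M)
         (preimages M (\<lambda>((j, r), b). fading_at net i m j r b) (edges net i \<times> uses net)
          \<union> preimages M (\<lambda>(r, b). noise_at net i m r b) (UNIV \<times> uses net)
          \<union> preimages M (\<lambda>j \<omega>. state net i j \<omega> $ m) UNIV)))"

definition expected_weight ::
  "'w measure \<Rightarrow> ('w, 'n, 'm::finite) network \<Rightarrow> nat \<Rightarrow> 'm \<Rightarrow> 'n \<Rightarrow> 'n \<Rightarrow> real" where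
  "expected_weight M net i m j r = integral\<^sup>L M (weight net i m j r)"

text \<open>
  No agent is its own neighbour; otherwise the diagonal blocks of \<^const>\<open>P_check\<close> would not be those
  of the stacked update.
\<close>

definition protocol_assumptions :: "'w measure \<Rightarrow> ('w, 'n::finite, 'm::finite) network \<Rightarrow> bool" where
  "protocol_assumptions M net \<longleftrightarrow>
     1 \<le> half_uses net \<and> dmin net < dmax net \<and> (\<forall>j. 0 < tx_power net j) \<and>
     (\<forall>i r. (r, r) \<notin> edges net i) \<and>
     (\<forall>i r. state net i r \<in> borel_measurable M \<and>
        (AE \<omega> in M. \<forall>m. state net i r \<omega> $ m \<in> {dmin net..dmax net})) \<and>
     code_assumptions M net \<and>
     (\<forall>i. beta net i \<in> {0<..1}) \<and>
     (\<forall>i. 0 < gamma net i \<and>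
        (\<forall>m. let d = (MAX r. \<Sum>j\<in>nbrs net i r. expected_weight M net i m j r) in
           0 < d \<and> gamma net i \<le> inverse d))"

text \<open>
  Edges of weight 0 do not count as edges of the expected graph.  There is one expected graph for
  each coordinate.  It is undirected by reciprocity, so that connectedness means that any two
  agents are joined by a directed path.
\<close>

definition expected_edges ::
  "'w measure \<Rightarrow> ('w, 'n, 'm::finite) network \<Rightarrow> nat \<Rightarrow> 'm \<Rightarrow> ('n \<times> 'n) set" where
  "expected_edges M net i m = {(j, r) \<in> edges net i. 0 < expected_weight M net i m j r}"

definition network_assumptions :: "'w measure \<Rightarrow> ('w, 'n, 'm::finite) network \<Rightarrow> bool" where
  "network_assumptions M net \<longleftrightarrow> (\<forall>i m.
     (\<forall>j r. (j, r) \<in> (expected_edges M net i m)\<^sup>*) \<and>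
     (\<forall>(j, r) \<in> edges net i. expected_weight M net i m j r = expected_weight M net i m r j))"


section \<open>The information-exchange model describes the protocol\<close>

text \<open>
  The update \<^const>\<open>h_next\<close>, stacked over the agents, is the relaxed iteration of \<^const>\<open>K_check\<close>.  The
  equality holds almost surely because edges \<open>(j, r)\<close> whose reverse is not an edge, which
  reciprocity allows, have weight 0 almost surely.
\<close>

lemma integrable_weight:
  assumes "channel_assumptions M net"
  shows "integrable M (weight net i m j r)"
proof (cases "(j, r) \<in> edges net i")
  case True
  then have j: "j \<in> nbrs net i r" by (simp add: nbrs_def)
  let ?X = "fading net i m j r" and ?Y = "fading_at net i m j r"
  from assms j have re: "realizations M ?X ?Y (uses net)"
    and int: "integrable M (\<lambda>\<omega>. (cmod (?X \<omega>))\<^sup>2)"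
    by (auto simp: channel_assumptions_def)
  have use: "integrable M (\<lambda>\<omega>. (cmod (?Y b \<omega>))\<^sup>2)" if "b \<in> uses net" for b
  proof -
    from re that have X: "?X \<in> borel_measurable M" and Y: "?Y b \<in> borel_measurable M"
      and d: "distr M borel (?Y b) = distr M borel ?X"
      by (auto simp: realizations_def)
    have "integrable (distr M borel ?X) (\<lambda>z. (cmod z)\<^sup>2)"
      using int X by (simp add: integrable_distr_eq)
    then show ?thesis
      unfolding d[symmetric] using Y by (simp add: integrable_distr_eq)
  qed
  have odd_use: "integrable M (\<lambda>\<omega>. (cmod (?Y (2 * b - 1) \<omega>))\<^sup>2)" if "b \<in> {1..half_uses net}" for b
  proof -
    have "2 * b - 1 \<in> uses net" using that by (simp add: uses_def) arith
    then show ?thesis by (rule use)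
  qed
  have "integrable M (\<lambda>\<omega>. \<Sum>b=1..half_uses net. (cmod (?Y (2 * b - 1) \<omega>))\<^sup>2)"
    by (rule Bochner_Integration.integrable_sum) (rule odd_use)
  then have "integrable M (\<lambda>\<omega>. tx_power net j / real (half_uses net) *
      (\<Sum>b=1..half_uses net. (cmod (?Y (2 * b - 1) \<omega>))\<^sup>2))"
    by (rule integrable_mult_right)
  then show ?thesis
    using True by (simp only: weight_def[abs_def] if_True)
next
  case False
  then show ?thesis by (simp add: weight_def[abs_def])
qed

lemma one_way_weight_zero:
  assumes ch: "channel_assumptions M net" and pr: "protocol_assumptions M net"
    and nw: "network_assumptions M net" and nrev: "(r, j) \<notin> edges net i"
  shows "AE \<omega> in M. weight net i m j r \<omega> = 0"
proof (cases "(j, r) \<in> edges net i")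
  case True
  with nw have "expected_weight M net i m j r = expected_weight M net i m r j"
    unfolding network_assumptions_def by blast
  also have "\<dots> = 0" using nrev by (simp add: expected_weight_def weight_def[abs_def])
  finally have "integral\<^sup>L M (weight net i m j r) = 0" by (simp add: expected_weight_def)
  moreover have "0 \<le> weight net i m j r \<omega>" for \<omega>
    using pr by (auto simp: weight_def protocol_assumptions_def less_imp_le intro!: sum_nonneg
      mult_nonneg_nonneg divide_nonneg_nonneg)
  ultimately show ?thesis
    using integral_nonneg_eq_0_iff_AE[OF integrable_weight[OF ch]] by simp
qed (simp add: weight_def)

lemma stacked_update:
  fixes net :: "('w, 'n::finite, 'm::finite) network"
  assumes ch: "channel_assumptions M net" and pr: "protocol_assumptions M net"
    and nw: "network_assumptions M net"
  shows "AE \<omega> in M. stack (\<lambda>r. h_next M net i r \<omega>) =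
    (1 - beta net i) *\<^sub>R stack (\<lambda>r. state net i r \<omega>)
      + beta net i *\<^sub>R K_check M net i \<omega> (stack (\<lambda>r. state net i r \<omega>))"
proof -
  have "AE \<omega> in M. \<forall>r j m. (r, j) \<notin> edges net i \<longrightarrow> weight net i m j r \<omega> = 0"
    using one_way_weight_zero[OF ch pr nw]
    by (simp add: AE_all_countable AE_finite_allI)
  then show ?thesis
  proof eventually_elim
    case (elim \<omega>)
    define g where "g = gamma net i"
    define w where "w = (\<lambda>m j r. weight net i m j r \<omega>)"
    define x where "x = (\<lambda>r m. state net i r \<omega> $ m)"
    have irr: "(r, r) \<notin> edges net i" for r using pr by (auto simp: protocol_assumptions_def)
    have P: "(P_check net i \<omega> *v stack (\<lambda>r. state net i r \<omega>)) $ (p, m) =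
       x p m - g * (\<Sum>j\<in>nbrs net i p. w m j p) * x p m + g * (\<Sum>j\<in>nbrs net i p. w m j p * x j m)"
      for p m
    proof -
      let ?S = "\<Sum>j\<in>nbrs net i p. w m j p"
      have one_way: "w m q p = 0" if "(p, q) \<notin> edges net i" for q
        using elim that by (simp add: w_def)
      have off_edge: "w m q p = 0" if "(q, p) \<notin> edges net i" for q
        using that by (simp add: w_def weight_def)
      have "(P_check net i \<omega> *v stack (\<lambda>r. state net i r \<omega>)) $ (p, m) =
        (\<Sum>q\<in>UNIV. \<Sum>k\<in>UNIV. P_check net i \<omega> $ (p, m) $ (q, k) * x q k)"
        by (simp add: matrix_vector_mult_def sum.cartesian_product UNIV_Times_UNIV[symmetric]
          stack_def x_def case_prod_beta del: UNIV_Times_UNIV)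
      also have "\<dots> = (\<Sum>q\<in>UNIV. (if p = q then (1 - g * ?S) * x q m
          else if (p, q) \<in> edges net i then g * w m q p * x q m else 0))"
      proof (rule sum.cong[OF refl])
        fix q
        have "P_check net i \<omega> $ (p, m) $ (q, k) * x q k =
          (if k = m then (if p = q then (1 - g * ?S) * x q m
          else if (p, q) \<in> edges net i then g * w m q p * x q m else 0) else 0)" for k
          by (auto simp: P_check_def block_matrix_def Z_mat_def Diag_def mat_def g_def w_def)
        then show "(\<Sum>k\<in>UNIV. P_check net i \<omega> $ (p, m) $ (q, k) * x q k) =
          (if p = q then (1 - g * ?S) * x q m
          else if (p, q) \<in> edges net i then g * w m q p * x q m else 0)"
          by simp
      qed
      also have "\<dots> = (\<Sum>q\<in>UNIV. (if q = p then (1 - g * ?S) * x p m else 0) +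
          (if q \<in> nbrs net i p then g * (w m q p * x q m) else 0))"
        using one_way off_edge irr by (intro sum.cong) (auto simp: nbrs_def)
      also have "\<dots> = (1 - g * ?S) * x p m + g * (\<Sum>q\<in>nbrs net i p. w m q p * x q m)"
        by (simp add: sum.distrib sum.If_cases sum_distrib_left)
      finally show ?thesis by (simp add: algebra_simps)
    qed
    have W: "(W_check M net i \<omega> *v stack (\<lambda>r. state net i r \<omega>)) $ (p, m) =
       - g * err' M net i m p \<omega> * x p m" for p m
    proof -
      have "W_check M net i \<omega> $ (p, m) $ a * stack (\<lambda>r. state net i r \<omega>) $ a =
        (if a = (p, m) then - g * err' M net i m p \<omega> * x p m else 0)" for a
        by (auto simp: W_check_def Diag_def stack_def n_acute_def g_def x_def)
      then show ?thesis by (simp add: matrix_vector_mult_def)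
    qed
    show ?case
    proof (unfold vec_eq_iff, intro allI)
      fix a :: "'n \<times> 'm"
      obtain p m where a: "a = (p, m)" by fastforce
      show "stack (\<lambda>r. h_next M net i r \<omega>) $ a =
        ((1 - beta net i) *\<^sub>R stack (\<lambda>r. state net i r \<omega>)
          + beta net i *\<^sub>R K_check M net i \<omega> (stack (\<lambda>r. state net i r \<omega>))) $ a"
        unfolding a K_check_def matrix_vector_mult_add_rdistrib
        by (simp add: P W)
           (simp add: stack_def h_next_def n_check_def n_tilde_def err_def err'_def g_def w_def x_def
             algebra_simps)
    qed
  qed
qed

end

theory Submission
  imports Defs
begin

text \<open>
  In a channel use, \<open>|q\<^sub>r|\<^sup>2\<close> splits into the energies \<open>|\<xi>\<^sub>j\<^sub>r s\<^sub>j|\<^sup>2\<close>, which make up the weights \<open>\<nu>\<^sub>j\<^sub>r\<close>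
  because \<open>|U\<^sub>j| = 1\<close>, the noise energy, and cross terms that contain a factor \<open>U\<^sub>j\<close> or
  \<open>U\<^sub>j cnj U\<^sub>k\<close>.  These factors have mean zero and are independent of the channel and of the inputs, so
  the cross terms have mean zero even after multiplication by a weight; the noise energy minus
  its mean has this property since noise and fading are independent.  Fourth moments of
  the channel make all products of two weights or errors integrable.  The expectation of \<open>P\<close> is
  symmetric and stochastic, hence has spectral norm and spectral radius 1, and its quadratic form is
  \<open>|x|\<^sup>2\<close> minus a weighted sum of the \<open>(x\<^sub>a - x\<^sub>b)\<^sup>2\<close>, which by connectivity vanishes only on
  the consensus subspace; compactness of the unit sphere then yields the spectral gap.
\<close>

subsection \<open>Symmetric stochastic matrices\<close>

lemma matrix_vector_component: "(A *v x) $ a = (\<Sum>b\<in>UNIV. A $ a $ b * x $ b)"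
  by (simp add: matrix_vector_mult_def)

lemma norm_vec_square: "(norm (x :: real^'k::finite))\<^sup>2 = (\<Sum>a\<in>UNIV. (x $ a)\<^sup>2)"
  by (subst power2_norm_eq_inner) (simp add: inner_vec_def power2_eq_square)

lemma spectral_norm_bound: "norm (A *v x) \<le> spectral_norm A * norm x"
  unfolding spectral_norm_def by (rule onorm[OF matrix_vector_mul_bounded_linear])

lemma spectral_norm_nonneg: "0 \<le> spectral_norm A"
  unfolding spectral_norm_def by (rule onorm_pos_le[OF matrix_vector_mul_bounded_linear])

text \<open>By Cauchy-Schwarz, one test vector with Rayleigh quotient 1 suffices. The all-ones
  vector serves for the mean of \<open>P_check\<close> and for its second-moment matrix.\<close>

lemma one_le_spectral_norm:
  fixes A :: "real^'k::finite^'k"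
  assumes "v \<noteq> 0" and "v \<bullet> (A *v v) = (norm v)\<^sup>2"
  shows "1 \<le> spectral_norm A"
proof -
  have "(norm v)\<^sup>2 \<le> norm v * norm (A *v v)"
    using assms(2) norm_cauchy_schwarz[of v "A *v v"] by simp
  also have "\<dots> \<le> norm v * (spectral_norm A * norm v)"
    by (intro mult_left_mono spectral_norm_bound) simp
  finally show ?thesis
    using assms(1) by (simp add: power2_eq_square algebra_simps)
qed

text \<open>Isolates the spectral theory of the mean matrix: the expectation of
  \<open>P_check\<close> is an instance, by reciprocity and the bound on
  \<open>gamma\<close>.\<close>

locale symmetric_stochastic =
  fixes A :: "real^'k::finite^'k"
  assumes nonneg: "0 \<le> A $ a $ b"
    and sym: "A $ a $ b = A $ b $ a"
    and row_sum: "(\<Sum>b\<in>UNIV. A $ a $ b) = 1"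
begin

lemma col_sum: "(\<Sum>a\<in>UNIV. A $ a $ b) = 1"
  using row_sum[of b] by (simp add: sym[of _ b])

text \<open>Expanding the square produces \<open>(norm x)\<^sup>2\<close> twice, once from row sums
  and once from column sums, whence the factor 1/2. The double sum is the Dirichlet form of the
  weighted graph with weights \<open>A\<close>.\<close>

lemma quadratic_form:
  "x \<bullet> (A *v x) = (norm x)\<^sup>2 - (\<Sum>a\<in>UNIV. \<Sum>b\<in>UNIV. A $ a $ b * (x $ a - x $ b)\<^sup>2) / 2"
proof -
  have "(\<Sum>a\<in>UNIV. \<Sum>b\<in>UNIV. A $ a $ b * (x $ a - x $ b)\<^sup>2) =
    (\<Sum>a\<in>UNIV. \<Sum>b\<in>UNIV. A $ a $ b * (x $ a)\<^sup>2) + (\<Sum>a\<in>UNIV. \<Sum>b\<in>UNIV. A $ a $ b * (x $ b)\<^sup>2)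
      - 2 * (\<Sum>a\<in>UNIV. \<Sum>b\<in>UNIV. x $ a * (A $ a $ b * x $ b))"
    by (simp add: sum.distrib[symmetric] sum_subtractf[symmetric] sum_distrib_left power2_diff
      algebra_simps)
  also have "(\<Sum>a\<in>UNIV. \<Sum>b\<in>UNIV. A $ a $ b * (x $ a)\<^sup>2) = (norm x)\<^sup>2"
    by (simp add: sum_distrib_right[symmetric] row_sum norm_vec_square)
  also have "(\<Sum>a\<in>UNIV. \<Sum>b\<in>UNIV. A $ a $ b * (x $ b)\<^sup>2) = (norm x)\<^sup>2"
    by (subst sum.swap)
       (simp add: sum_distrib_right[symmetric] col_sum norm_vec_square)
  also have "(\<Sum>a\<in>UNIV. \<Sum>b\<in>UNIV. x $ a * (A $ a $ b * x $ b)) = x \<bullet> (A *v x)"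
    by (simp add: inner_vec_def matrix_vector_component sum_distrib_left)
  finally show ?thesis by (simp add: field_simps)
qed

lemma mult_ones: "A *v (\<chi> a. 1) = (\<chi> a. 1)"
  by (simp add: vec_eq_iff matrix_vector_component row_sum)

text \<open>Jensen's inequality in each row, whose entries are probability weights; summing over the
  rows then uses that the columns also sum to 1.\<close>

lemma norm_mult_le: "norm (A *v x) \<le> norm x"
proof -
  have "((A *v x) $ a)\<^sup>2 \<le> (\<Sum>b\<in>UNIV. A $ a $ b * (x $ b)\<^sup>2)" for a
  proof -
    \<comment> \<open>The variance of the entries of \<open>x\<close> under the weights of row
      \<open>a\<close>, whose mean is \<open>(A *v x) $ a\<close>.\<close>
    have "0 \<le> (\<Sum>b\<in>UNIV. A $ a $ b * (x $ b - (A *v x) $ a)\<^sup>2)"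
      by (intro sum_nonneg mult_nonneg_nonneg nonneg) simp
    also have "\<dots> = (\<Sum>b\<in>UNIV. A $ a $ b * (x $ b)\<^sup>2)
        - 2 * (A *v x) $ a * (\<Sum>b\<in>UNIV. A $ a $ b * x $ b)
        + ((A *v x) $ a)\<^sup>2 * (\<Sum>b\<in>UNIV. A $ a $ b)"
      unfolding sum_distrib_left by (simp add: sum.distrib[symmetric] sum_subtractf[symmetric] sum_distrib_left power2_diff
        algebra_simps)
    also have "\<dots> = (\<Sum>b\<in>UNIV. A $ a $ b * (x $ b)\<^sup>2) - ((A *v x) $ a)\<^sup>2"
      by (simp add: row_sum matrix_vector_component[symmetric] power2_eq_square)
    finally show ?thesis by simp
  qed
  then have "(norm (A *v x))\<^sup>2 \<le> (\<Sum>a\<in>UNIV. \<Sum>b\<in>UNIV. A $ a $ b * (x $ b)\<^sup>2)"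
    by (simp add: norm_vec_square sum_mono)
  also have "\<dots> = (norm x)\<^sup>2"
    by (subst sum.swap)
       (simp add: sum_distrib_right[symmetric] col_sum norm_vec_square)
  finally show ?thesis by (simp add: power2_le_iff_abs_le)
qed

lemma spectral_norm_eq: "spectral_norm A = 1"
proof (rule antisym)
  show "spectral_norm A \<le> 1"
    unfolding spectral_norm_def by (rule onorm_le) (simp add: norm_mult_le)
  show "1 \<le> spectral_norm A"
    by (rule one_le_spectral_norm[of "\<chi> a. 1"])
       (auto simp: mult_ones vec_eq_iff power2_norm_eq_inner)
qed

section \<open>Complex eigenvalues\<close>

abbreviation cmult :: "complex^'k \<Rightarrow> complex^'k" where
  "cmult v \<equiv> map_matrix complex_of_real A *v v"

lemma cmult_component: "cmult v $ a = (\<Sum>b\<in>UNIV. complex_of_real (A $ a $ b) * v $ b)"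
  by (simp add: matrix_vector_mult_def map_matrix_def)

text \<open>The inner product on \<open>complex^'k\<close> is the real part of the Hermitian
  product, and real symmetric entries can be moved across it.\<close>

lemma cmult_self_adjoint: "cmult v \<bullet> w = v \<bullet> cmult w"
proof -
  have "cmult v \<bullet> w = (\<Sum>a\<in>UNIV. \<Sum>b\<in>UNIV. A $ a $ b * (v $ b \<bullet> w $ a))"
    by (simp add: inner_vec_def cmult_component inner_sum_left scaleR_conv_of_real[symmetric])
  also have "\<dots> = (\<Sum>b\<in>UNIV. \<Sum>a\<in>UNIV. A $ b $ a * (v $ b \<bullet> w $ a))"
    by (subst sum.swap) (simp add: sym)
  also have "\<dots> = v \<bullet> cmult w"
    by (simp add: inner_vec_def cmult_component inner_sum_right scaleR_conv_of_real[symmetric])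
  finally show ?thesis .
qed

text \<open>Self-adjointness is tested on \<open>v\<close> and \<open>\<i> *s v\<close>: the two
  sides are \<open>Im z\<close> and \<open>- Im z\<close> times
  \<open>v \<bullet> v\<close>.\<close>

lemma eigenvalue_real:
  assumes "v \<noteq> 0" and "cmult v = z *s v"
  shows "Im z = 0"
proof -
  have sm: "cmult (\<i> *s v) = \<i> *s cmult v"
    by (simp add: vec_eq_iff cmult_component sum_distrib_left mult_ac)
  have "cmult v \<bullet> (\<i> *s v) = Im z * (v \<bullet> v)"
    by (simp add: assms(2) inner_vec_def inner_complex_def sum_distrib_left algebra_simps)
  moreover have "v \<bullet> cmult (\<i> *s v) = - (Im z * (v \<bullet> v))"
    by (simp add: sm assms(2) inner_vec_def inner_complex_def sum_distrib_left
      algebra_simps sum_negf[symmetric])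
  ultimately show ?thesis
    using cmult_self_adjoint[of v "\<i> *s v"] assms(1) by simp
qed

text \<open>Eigenvectors of distinct eigenvalues are orthogonal, so there are finitely many; otherwise the
  maximum in \<^const>\<open>spectral_radius\<close> would be unspecified.\<close>

lemma finite_eigenvalues: "finite {z. \<exists>v. v \<noteq> 0 \<and> cmult v = z *s v}" (is "finite ?E")
proof -
  define vec where "vec z = (SOME v. v \<noteq> 0 \<and> cmult v = z *s v)" for z
  have vec: "vec z \<noteq> 0" "cmult (vec z) = z *s vec z" if "z \<in> ?E" for z
    using someI_ex[of "\<lambda>v. v \<noteq> 0 \<and> cmult v = z *s v"] that by (auto simp: vec_def)
  \<comment> \<open>Eigenvalues are real, so the eigenvector equation is a real scaling, which the
    real inner product respects.\<close>
  have real_scale: "z *s v = Re z *\<^sub>R v" if "Im z = 0" for z :: complex and v :: "complex^'k"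
    using that by (simp add: vec_eq_iff complex_eq_iff)
  have orth: "vec z \<bullet> vec w = 0" if z: "z \<in> ?E" and w: "w \<in> ?E" and ne: "z \<noteq> w" for z w
  proof -
    have "Im z = 0" "Im w = 0" using vec[OF z] vec[OF w] eigenvalue_real by blast+
    then have "Re z * (vec z \<bullet> vec w) = Re w * (vec z \<bullet> vec w)" and "Re z \<noteq> Re w"
      using cmult_self_adjoint[of "vec z" "vec w"] ne
      by (simp_all add: vec[OF z] vec[OF w] real_scale complex_eq_iff)
    then show ?thesis by simp
  qed
  \<comment> \<open>A common eigenvector of two distinct eigenvalues would be orthogonal to itself,
    hence zero. Injectivity carries finiteness of the orthogonal family back to the
    eigenvalues.\<close>
  have "inj_on vec ?E"
    using orth vec(1) by (metis (no_types, lifting) inj_onI inner_eq_zero_iff)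
  moreover have "finite (vec ` ?E)"
    by (rule pairwise_orthogonal_imp_finite)
       (use orth in \<open>auto simp: pairwise_def orthogonal_def\<close>)
  ultimately show ?thesis using finite_imageD by blast
qed

text \<open>The eigenvector equation is read at a coordinate where \<open>v\<close> has maximal
  modulus: a weighted average of moduli cannot exceed that maximum.\<close>

lemma eigenvalue_bound:
  assumes "v \<noteq> 0" and eig: "cmult v = z *s v"
  shows "cmod z \<le> 1"
proof -
  have "Max (range (\<lambda>a. cmod (v $ a))) \<in> range (\<lambda>a. cmod (v $ a))"
    by (rule Max_in) auto
  then obtain a where a: "cmod (v $ a) = Max (range (\<lambda>a. cmod (v $ a)))" by force
  have max: "cmod (v $ b) \<le> cmod (v $ a)" for b
    unfolding a by (rule Max_ge) auto
  obtain b where "v $ b \<noteq> 0" using assms(1) by (auto simp: vec_eq_iff)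
  with max[of b] have pos: "0 < cmod (v $ a)" by (smt (verit) zero_less_norm_iff)
  have "cmod z * cmod (v $ a) = cmod (\<Sum>b\<in>UNIV. complex_of_real (A $ a $ b) * v $ b)"
    using arg_cong[OF eig, of "\<lambda>u. cmod (u $ a)"] by (simp add: cmult_component norm_mult)
  also have "\<dots> \<le> (\<Sum>b\<in>UNIV. A $ a $ b * cmod (v $ b))"
    by (rule order_trans[OF norm_sum]) (simp add: norm_mult nonneg)
  also have "\<dots> \<le> (\<Sum>b\<in>UNIV. A $ a $ b * cmod (v $ a))"
    by (intro sum_mono mult_left_mono max nonneg)
  also have "\<dots> = cmod (v $ a)" by (simp add: sum_distrib_right[symmetric] row_sum)
  finally show ?thesis using pos by simp
qed

lemma spectral_radius_eq: "spectral_radius A = 1"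
proof -
  let ?S = "{cmod z |z. \<exists>v. v \<noteq> 0 \<and> cmult v = z *s v}"
  have "?S = cmod ` {z. \<exists>v. v \<noteq> 0 \<and> cmult v = z *s v}" by blast
  then have "finite ?S" using finite_eigenvalues by simp
  moreover have "1 \<in> ?S"
  proof -
    have "cmult (\<chi> a. 1) = 1 *s (\<chi> a. 1)"
      by (simp add: vec_eq_iff cmult_component of_real_sum[symmetric] row_sum del: of_real_sum)
    moreover have "(\<chi> a. 1) \<noteq> (0 :: complex^'k)" by (simp add: vec_eq_iff)
    ultimately show ?thesis by (metis (mono_tags, lifting) mem_Collect_eq norm_one)
  qed
  moreover have "x \<le> 1" if "x \<in> ?S" for x using that eigenvalue_bound by blast
  ultimately show ?thesis unfolding spectral_radius_def by (intro Max_eqI) auto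
qed

text \<open>The quadratic form attains its maximum on the compact unit sphere of \<open>S\<close>. A
  maximal value 1 would make every term of the Dirichlet sum vanish, so by \<open>level\<close> the
  maximizer would be zero.\<close>

lemma spectral_gap:
  fixes S :: "(real^'k) set"
  assumes S: "subspace S"
    and level: "\<And>x. x \<in> S \<Longrightarrow> (\<And>a b. 0 < A $ a $ b \<Longrightarrow> x $ a = x $ b) \<Longrightarrow> x = 0"
  shows "\<exists>\<epsilon>. 0 < \<epsilon> \<and> \<epsilon> \<le> 1 \<and> (\<forall>x\<in>S. norm x = 1 \<longrightarrow> x \<bullet> (A *v x) \<le> 1 - \<epsilon>)"
proof (cases "S \<inter> sphere 0 1 = {}")
  case True
  then show ?thesis by (intro exI[of _ 1]) auto
next
  case False
  have "compact (S \<inter> sphere 0 1)"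
    using closed_subspace[OF S] by (simp add: closed_Int_compact)
  moreover have "continuous_on (S \<inter> sphere 0 1) (\<lambda>x. x \<bullet> (A *v x))"
    by (intro continuous_intros linear_continuous_on matrix_vector_mul_bounded_linear)
  ultimately obtain y where y: "y \<in> S \<inter> sphere 0 1"
    and max: "\<And>x. x \<in> S \<inter> sphere 0 1 \<Longrightarrow> x \<bullet> (A *v x) \<le> y \<bullet> (A *v y)"
    using continuous_attains_sup[OF _ False] by blast
  let ?s = "\<Sum>a\<in>UNIV. \<Sum>b\<in>UNIV. A $ a $ b * (y $ a - y $ b)\<^sup>2"
  have summand: "0 \<le> A $ a $ b * (y $ a - y $ b)\<^sup>2" for a b by (simp add: nonneg)
  have "?s \<noteq> 0"
  proof
    assume "?s = 0"
    then have "A $ a $ b * (y $ a - y $ b)\<^sup>2 = 0" for a b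
      by (simp add: sum_nonneg_eq_0_iff summand sum_nonneg)
    then have "y = 0" using y by (intro level) (auto, metis less_irrefl)
    then show False using y by simp
  qed
  moreover have "0 \<le> ?s" by (intro sum_nonneg summand)
  ultimately have "y \<bullet> (A *v y) < 1" using y quadratic_form[of y] by simp
  \<comment> \<open>The minimum keeps \<epsilon> at most 1 when the maximal value is
    negative.\<close>
  then show ?thesis
    using max by (intro exI[of _ "min 1 (1 - y \<bullet> (A *v y))"]) (auto, force)
qed

end

subsection \<open>Moments of random vectors\<close>

text \<open>Integrability of \<open>norm (X \<omega>) ^ k\<close> does not make \<open>X\<close>
  itself measurable. Channel quantities have order 4, weights and errors order 2, and their products
  order 1.\<close>

definition has_moment :: "'w measure \<Rightarrow> nat \<Rightarrow> ('w \<Rightarrow> 'b::{banach, second_countable_topology}) \<Rightarrow> bool"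
  where "has_moment M k X \<longleftrightarrow> X \<in> borel_measurable M \<and> integrable M (\<lambda>\<omega>. norm (X \<omega>) ^ k)"

lemma has_moment_measurable: "has_moment M k X \<Longrightarrow> X \<in> borel_measurable M"
  by (simp add: has_moment_def)

lemma has_moment_1: "has_moment M (Suc 0) X \<Longrightarrow> integrable M X"
  by (rule integrable_norm_cancel) (simp_all add: has_moment_def)

lemma has_moment_dominated:
  assumes Y: "has_moment M k Y" and X: "X \<in> borel_measurable M"
    and le: "AE \<omega> in M. norm (X \<omega>) \<le> C * norm (Y \<omega>)"
  shows "has_moment M k X"
  unfolding has_moment_def
proof
  have "integrable M (\<lambda>\<omega>. C ^ k * norm (Y \<omega>) ^ k)"
    using Y by (simp add: has_moment_def)
  moreover have "AE \<omega> in M. norm (norm (X \<omega>) ^ k) \<le> norm (C ^ k * norm (Y \<omega>) ^ k)"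
    using le
  proof eventually_elim
    case (elim \<omega>)
    then have "norm (X \<omega>) ^ k \<le> (C * norm (Y \<omega>)) ^ k" by (intro power_mono) auto
    then show ?case by (simp add: power_mult_distrib)
  qed
  moreover have "(\<lambda>\<omega>. norm (X \<omega>) ^ k) \<in> borel_measurable M" using X by measurable
  ultimately show "integrable M (\<lambda>\<omega>. norm (X \<omega>) ^ k)"
    using Bochner_Integration.integrable_bound by blast
qed (rule X)

lemma has_moment_zero: "0 < k \<Longrightarrow> has_moment M k (\<lambda>_. 0)"
  by (simp add: has_moment_def zero_power)

lemma has_moment_add:
  assumes X: "has_moment M k X" and Y: "has_moment M k Y"
  shows "has_moment M k (\<lambda>\<omega>. X \<omega> + Y \<omega>)"
  unfolding has_moment_def
proof
  have [measurable]: "X \<in> borel_measurable M" "Y \<in> borel_measurable M"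
    using X Y by (simp_all add: has_moment_def)
  show "(\<lambda>\<omega>. X \<omega> + Y \<omega>) \<in> borel_measurable M" by measurable
  \<comment> \<open>The factor \<open>2 ^ k\<close> comes from bounding the norm of the sum by twice
    the larger of the two norms.\<close>
  have "integrable M (\<lambda>\<omega>. 2 ^ k * (norm (X \<omega>) ^ k + norm (Y \<omega>) ^ k))"
    using X Y by (simp add: has_moment_def)
  then show "integrable M (\<lambda>\<omega>. norm (X \<omega> + Y \<omega>) ^ k)"
  proof (rule Bochner_Integration.integrable_bound)
    show "AE \<omega> in M. norm (norm (X \<omega> + Y \<omega>) ^ k) \<le> norm (2 ^ k * (norm (X \<omega>) ^ k + norm (Y \<omega>) ^ k))"
    proof (rule AE_I2)
      fix \<omega>
      have "norm (X \<omega> + Y \<omega>) \<le> 2 * max (norm (X \<omega>)) (norm (Y \<omega>))"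
        using norm_triangle_ineq[of "X \<omega>" "Y \<omega>"] by linarith
      then have "norm (X \<omega> + Y \<omega>) ^ k \<le> (2 * max (norm (X \<omega>)) (norm (Y \<omega>))) ^ k"
        by (rule power_mono) simp
      also have "\<dots> = 2 ^ k * max (norm (X \<omega>)) (norm (Y \<omega>)) ^ k" by (rule power_mult_distrib)
      also have "\<dots> \<le> 2 ^ k * (norm (X \<omega>) ^ k + norm (Y \<omega>) ^ k)"
        by (intro mult_left_mono) (auto simp: max_def)
      finally show "norm (norm (X \<omega> + Y \<omega>) ^ k) \<le> norm (2 ^ k * (norm (X \<omega>) ^ k + norm (Y \<omega>) ^ k))"
        by simp
    qed
  qed measurable
qed

lemma has_moment_sum:
  assumes "0 < k" and "\<And>j. j \<in> J \<Longrightarrow> has_moment M k (X j)"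
  shows "has_moment M k (\<lambda>\<omega>. \<Sum>j\<in>J. X j \<omega>)"
proof (cases "finite J")
  case True
  then show ?thesis
    using assms(2) by (induction J) (simp_all add: has_moment_zero[OF assms(1)] has_moment_add)
qed (simp add: has_moment_zero[OF assms(1)])

lemma has_moment_scale:
  fixes X :: "'w \<Rightarrow> 'b::{banach, second_countable_topology, real_normed_algebra}"
  assumes "has_moment M k X"
  shows "has_moment M k (\<lambda>\<omega>. c * X \<omega>)"
  using assms
  by (rule has_moment_dominated)
     (use has_moment_measurable[OF assms] in \<open>auto intro: norm_mult_ineq\<close>)

lemma has_moment_norm_power: "has_moment M (l * k) X \<Longrightarrow> has_moment M k (\<lambda>\<omega>. norm (X \<omega>) ^ l)"
  by (auto simp: has_moment_def power_mult[symmetric])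

text \<open>The inequality \<open>x * y \<le> x\<^sup>2 + y\<^sup>2\<close> is applied to the k-th
  powers of the norms.\<close>

lemma has_moment_mult:
  fixes X Y :: "'w \<Rightarrow> 'b::{banach, second_countable_topology, real_normed_algebra}"
  assumes X: "has_moment M (2 * k) X" and Y: "has_moment M (2 * k) Y"
  shows "has_moment M k (\<lambda>\<omega>. X \<omega> * Y \<omega>)"
  unfolding has_moment_def
proof
  have [measurable]: "X \<in> borel_measurable M" "Y \<in> borel_measurable M"
    using X Y by (simp_all add: has_moment_def)
  show "(\<lambda>\<omega>. X \<omega> * Y \<omega>) \<in> borel_measurable M" by measurable
  have "integrable M (\<lambda>\<omega>. norm (X \<omega>) ^ (2 * k) + norm (Y \<omega>) ^ (2 * k))"
    using X Y by (simp add: has_moment_def)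
  then show "integrable M (\<lambda>\<omega>. norm (X \<omega> * Y \<omega>) ^ k)"
  proof (rule Bochner_Integration.integrable_bound)
    show "AE \<omega> in M. norm (norm (X \<omega> * Y \<omega>) ^ k) \<le> norm (norm (X \<omega>) ^ (2 * k) + norm (Y \<omega>) ^ (2 * k))"
    proof (rule AE_I2)
      fix \<omega>
      define x y where "x = norm (X \<omega>) ^ k" and "y = norm (Y \<omega>) ^ k"
      have nn: "0 \<le> x" "0 \<le> y" by (simp_all add: x_def y_def)
      have "norm (X \<omega> * Y \<omega>) ^ k \<le> (norm (X \<omega>) * norm (Y \<omega>)) ^ k"
        by (intro power_mono norm_mult_ineq) simp
      also have "\<dots> = x * y" by (simp add: power_mult_distrib x_def y_def)
      also have "\<dots> \<le> x\<^sup>2 + y\<^sup>2"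
        using sum_squares_bound[of x y] mult_nonneg_nonneg[OF nn] by linarith
      finally show "norm (norm (X \<omega> * Y \<omega>) ^ k) \<le> norm (norm (X \<omega>) ^ (2 * k) + norm (Y \<omega>) ^ (2 * k))"
        by (simp add: x_def y_def power_mult[symmetric] mult.commute)
    qed
  qed measurable
qed

lemma integrable_mult_square_moment:
  fixes X Y :: "'w \<Rightarrow> 'b::{banach, second_countable_topology, real_normed_algebra}"
  assumes "has_moment M 2 X" and "has_moment M 2 Y"
  shows "integrable M (\<lambda>\<omega>. X \<omega> * Y \<omega>)"
  by (rule has_moment_1, rule has_moment_mult) (use assms in simp_all)

text \<open>Moments are assumed for the nominal channel variables; their realizations inherit them
  through equality of distributions.\<close>

lemma has_moment_cong_distr:
  assumes "has_moment M k X" and Y: "Y \<in> borel_measurable M"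
    and d: "distr M borel Y = distr M borel X"
  shows "has_moment M k Y"
proof -
  have X: "X \<in> borel_measurable M" using assms(1) by (rule has_moment_measurable)
  have "integrable (distr M borel X) (\<lambda>x. norm x ^ k)"
    using assms(1) X by (simp add: integrable_distr_eq has_moment_def)
  then show ?thesis
    unfolding d[symmetric] has_moment_def using Y by (simp add: integrable_distr_eq)
qed

lemma (in finite_measure) has_moment_const: "has_moment M k (\<lambda>_. c)"
  by (simp add: has_moment_def)

text \<open>Constants are integrable here, and \<open>x ^ k \<le> 1 + x ^ l\<close> for nonnegative
  \<open>x\<close>.\<close>

lemma (in finite_measure) has_moment_mono:
  assumes X: "has_moment M l X" and "k \<le> l"
  shows "has_moment M k X"
  unfolding has_moment_def
proof
  show "X \<in> borel_measurable M" using X by (rule has_moment_measurable)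
  then have [measurable]: "X \<in> borel_measurable M" .
  have "integrable M (\<lambda>\<omega>. 1 + norm (X \<omega>) ^ l)"
    using X by (simp add: has_moment_def)
  then show "integrable M (\<lambda>\<omega>. norm (X \<omega>) ^ k)"
  proof (rule Bochner_Integration.integrable_bound)
    have "x ^ k \<le> 1 + x ^ l" if "0 \<le> x" for x :: real
    proof (cases "x \<le> 1")
      case True
      then have "x ^ k \<le> 1" "0 \<le> x ^ l" using that by (auto simp: power_le_one)
      then show ?thesis by linarith
    next
      case False
      then have "x ^ k \<le> x ^ l" using assms(2) by (intro power_increasing) auto
      then show ?thesis by linarith
    qed
    then show "AE \<omega> in M. norm (norm (X \<omega>) ^ k) \<le> norm (1 + norm (X \<omega>) ^ l)"
      by (simp add: add_nonneg_nonneg)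
  qed measurable
qed

subsection \<open>Expectations of vectors and matrices\<close>

text \<open>A vector is the sum of its axis components, and the embeddings are bounded linear.
  Components in any Euclidean space are allowed, so that two applications cover matrices.\<close>

lemma has_bochner_integral_vec:
  fixes f :: "'w \<Rightarrow> 'b::euclidean_space^'k::finite"
  assumes "\<And>a. has_bochner_integral M (\<lambda>\<omega>. f \<omega> $ a) (x $ a)"
  shows "has_bochner_integral M f x"
proof -
  have ax: "bounded_linear (axis a :: 'b \<Rightarrow> 'b^'k)" for a
    unfolding linear_conv_bounded_linear[symmetric]
    by (rule linearI) (auto simp: axis_def vec_eq_iff)
  have expand: "(\<Sum>a\<in>UNIV. axis a (y $ a)) = y" for y :: "'b^'k"
    by (simp add: vec_eq_iff axis_def)
  have "has_bochner_integral M (\<lambda>\<omega>. \<Sum>a\<in>UNIV. axis a (f \<omega> $ a)) (\<Sum>a\<in>UNIV. axis a (x $ a))"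
    by (intro has_bochner_integral_sum has_bochner_integral_bounded_linear[OF ax] assms)
  then show ?thesis by (simp add: expand)
qed

lemma integrable_vec:
  fixes f :: "'w \<Rightarrow> 'b::euclidean_space^'k::finite"
  assumes "\<And>a. integrable M (\<lambda>\<omega>. f \<omega> $ a)"
  shows "integrable M f"
  using has_bochner_integral_vec[of M f "\<chi> a. integral\<^sup>L M (\<lambda>\<omega>. f \<omega> $ a)"] assms
  by (auto simp: has_bochner_integral_iff)

lemma integral_vec_nth:
  fixes f :: "'w \<Rightarrow> 'b::euclidean_space^'k::finite"
  assumes "integrable M f"
  shows "integral\<^sup>L M f $ a = integral\<^sup>L M (\<lambda>\<omega>. f \<omega> $ a)"
  using integral_bounded_linear[OF bounded_linear_vec_nth assms] by simp

lemma integrable_vec_nth: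
  fixes f :: "'w \<Rightarrow> 'b::euclidean_space^'k::finite"
  shows "integrable M f \<Longrightarrow> integrable M (\<lambda>\<omega>. f \<omega> $ a)"
  by (rule integrable_bounded_linear[OF bounded_linear_vec_nth])

lemma transpose_mult_nth: "(transpose A ** B) $ a $ b = (\<Sum>c\<in>UNIV. A $ c $ a * B $ c $ b)"
  by (simp add: matrix_matrix_mult_def transpose_def)

lemma transpose_vector_mult_nth: "(transpose A *v x) $ a = (\<Sum>c\<in>UNIV. A $ c $ a * x $ c)"
  by (simp add: matrix_vector_mult_def transpose_def)

lemma integrable_transpose_mult:
  fixes A B :: "'w \<Rightarrow> real^'k::finite^'k"
  assumes "\<And>a b. has_moment M 2 (\<lambda>\<omega>. A \<omega> $ a $ b)" and "\<And>a b. has_moment M 2 (\<lambda>\<omega>. B \<omega> $ a $ b)"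
  shows "integrable M (\<lambda>\<omega>. transpose (A \<omega>) ** B \<omega>)"
  by (intro integrable_vec) (auto simp: transpose_mult_nth intro!: integrable_mult_square_moment assms)

lemma integrable_transpose_vector_mult:
  fixes A :: "'w \<Rightarrow> real^'k::finite^'k"
  assumes "\<And>a b. has_moment M 2 (\<lambda>\<omega>. A \<omega> $ a $ b)" and "\<And>a. has_moment M 2 (\<lambda>\<omega>. x \<omega> $ a)"
  shows "integrable M (\<lambda>\<omega>. transpose (A \<omega>) *v x \<omega>)"
  by (rule integrable_vec, unfold transpose_vector_mult_nth,
    rule Bochner_Integration.integrable_sum, rule integrable_mult_square_moment; rule assms)

subsection \<open>Independence\<close>

text \<open>The restrictions of the family to the disjoint sets \<open>{k}\<close> and
  \<open>{l}\<close> are independent and are composed with evaluation.\<close>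

lemma (in prob_space) indep_vars_imp_indep_var:
  assumes ind: "indep_vars (\<lambda>_. N) X I" and "k \<in> I" "l \<in> I" "k \<noteq> l"
  shows "indep_var N (X k) N (X l)"
proof -
  have "indep_var (PiM {k} (\<lambda>_. N)) (\<lambda>\<omega>. restrict (\<lambda>i. X i \<omega>) {k})
      (PiM {l} (\<lambda>_. N)) (\<lambda>\<omega>. restrict (\<lambda>i. X i \<omega>) {l})"
    using assms by (intro indep_var_restrict[OF ind]) auto
  then have "indep_var N ((\<lambda>f. f k) \<circ> (\<lambda>\<omega>. restrict (\<lambda>i. X i \<omega>) {k}))
      N ((\<lambda>f. f l) \<circ> (\<lambda>\<omega>. restrict (\<lambda>i. X i \<omega>) {l}))"
    by (rule indep_var_compose) simp_all
  then show ?thesis by (simp add: comp_def)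
qed

text \<open>Measurability with respect to \<open>S\<close> puts the \<sigma>-algebra generated by
  \<open>X\<close> inside \<open>\<A>\<close>, and likewise for \<open>Y\<close>; independence
  passes to smaller families.\<close>

lemma (in prob_space) indep_var_of_indep_set:
  assumes ind: "indep_set \<A> \<B>"
    and X: "X \<in> borel_measurable S" "space S = space M" "sets S = \<A>"
    and Y: "Y \<in> borel_measurable T" "space T = space M" "sets T = \<B>"
  shows "indep_var borel X borel Y"
proof -
  have generated: "sigma_sets (space M) {Z -` A \<inter> space M |A. A \<in> sets borel} \<subseteq> sets N"
    if "Z \<in> borel_measurable N" "space N = space M" for Z :: "'a \<Rightarrow> 'z::topological_space" and N
    using sets.sigma_sets_subset[of "{Z -` A \<inter> space M |A. A \<in> sets borel}" N]
      measurable_sets[OF that(1)] that(2) by auto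
  have le: "sets S \<subseteq> sets M" "sets T \<subseteq> sets M"
    using indep_setD_ev1[OF ind] indep_setD_ev2[OF ind] X Y by auto
  have "indep_set (sigma_sets (space M) {X -` A \<inter> space M |A. A \<in> sets borel})
      (sigma_sets (space M) {Y -` A \<inter> space M |A. A \<in> sets borel})"
    using ind unfolding indep_set_def
    by (rule indep_sets_mono_sets)
       (use generated[OF X(1,2)] generated[OF Y(1,2)] X(3) Y(3) in \<open>auto split: bool.split\<close>)
  moreover have "X \<in> borel_measurable M"
    by (rule measurable_from_subalg[OF _ X(1)]) (use X le in \<open>simp add: subalgebra_def\<close>)
  moreover have "Y \<in> borel_measurable M"
    by (rule measurable_from_subalg[OF _ Y(1)]) (use Y le in \<open>simp add: subalgebra_def\<close>)
  ultimately show ?thesis by (simp add: indep_var_eq)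
qed

lemma (in prob_space) indep_var_has_integral_mult:
  fixes X Y :: "'a \<Rightarrow> 'b::{real_normed_field, banach, second_countable_topology}"
  assumes "indep_var borel X borel Y" and "integrable M X" and "integrable M Y"
  shows "has_bochner_integral M (\<lambda>\<omega>. X \<omega> * Y \<omega>) (integral\<^sup>L M X * integral\<^sup>L M Y)"
  using indep_var_integrable[OF assms] indep_var_lebesgue_integral[OF assms]
  by (simp add: has_bochner_integral_iff)

lemma Re_of_real_mult: "Re (complex_of_real x * z) = x * Re z"
  by simp

text \<open>The double sum is split into its diagonal and the ordered off-diagonal pairs. Both
  orders of a pair occur there, whereas the two mixed sums with \<open>w\<close> have equal real
  parts and give the factor 2.\<close>

lemma cmod_square_sum_add:
  fixes c :: "'k \<Rightarrow> complex"
  assumes "finite J"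
  shows "(cmod ((\<Sum>j\<in>J. c j) + w))\<^sup>2 = (\<Sum>j\<in>J. (cmod (c j))\<^sup>2)
    + (\<Sum>j\<in>J. \<Sum>k\<in>J - {j}. Re (c j * cnj (c k))) + 2 * (\<Sum>j\<in>J. Re (c j * cnj w)) + (cmod w)\<^sup>2"
proof -
  have sq: "(cmod z)\<^sup>2 = Re (z * cnj z)" for z by (simp add: cmod_power2) (simp add: power2_eq_square)
  have swap: "Re (w * cnj z) = Re (z * cnj w)" for z by simp
  have "Re ((\<Sum>j\<in>J. c j) * cnj (\<Sum>j\<in>J. c j)) = (\<Sum>j\<in>J. \<Sum>k\<in>J. Re (c j * cnj (c k)))"
    by (simp only: cnj_sum sum_product Re_sum)
  also have "\<dots> = (\<Sum>j\<in>J. (cmod (c j))\<^sup>2 + (\<Sum>k\<in>J - {j}. Re (c j * cnj (c k))))"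
    unfolding sq by (rule sum.cong[OF refl]) (rule sum.remove[OF assms])
  finally have diag: "Re ((\<Sum>j\<in>J. c j) * cnj (\<Sum>j\<in>J. c j)) =
    (\<Sum>j\<in>J. (cmod (c j))\<^sup>2) + (\<Sum>j\<in>J. \<Sum>k\<in>J - {j}. Re (c j * cnj (c k)))"
    by (simp only: sum.distrib)
  have mixed: "Re ((\<Sum>j\<in>J. c j) * cnj w) = (\<Sum>j\<in>J. Re (c j * cnj w))"
    by (simp only: sum_distrib_right Re_sum)
  have "(cmod ((\<Sum>j\<in>J. c j) + w))\<^sup>2 = Re ((\<Sum>j\<in>J. c j) * cnj (\<Sum>j\<in>J. c j))
      + Re ((\<Sum>j\<in>J. c j) * cnj w) + Re (w * cnj (\<Sum>j\<in>J. c j)) + Re (w * cnj w)"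
    unfolding sq complex_cnj_add by (simp only: algebra_simps plus_complex.sel)
  then show ?thesis unfolding swap[of "sum c J"] diag mixed sq[of w, symmetric] by simp
qed

lemma borel_measurable_cnj [measurable]: "cnj \<in> borel_measurable borel"
  by (intro borel_measurable_continuous_onI continuous_on_cnj continuous_on_id)

subsection \<open>One scalar run\<close>

text \<open>One time and one coordinate select one scalar run, the scope within which independence
  is assumed.\<close>

locale ota_run = prob_space M for M :: "'w measure" +
  fixes net :: "('w, 'n::finite, 'm::finite) network" and i :: nat and m :: 'm
  assumes protocol: "protocol_assumptions M net" and channel: "channel_assumptions M net"
begin

abbreviation "B \<equiv> half_uses net"
abbreviation "\<xi> \<equiv> fading_at net i m"
abbreviation "w \<equiv> noise_at net i m"
abbreviation "U \<equiv> tx_code net i m"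
abbreviation "\<nu> \<equiv> weight net i m"
abbreviation "m\<^sub>w \<equiv> noise_power M net i m"
abbreviation "nbr r \<equiv> nbrs net i r"

section \<open>The \<sigma>-algebras of the codes and of the channel\<close>

definition code_gen :: "'w set set" where
  "code_gen = preimages M (\<lambda>(j, b). U j b) (UNIV \<times> uses net)"

text \<open>The inputs are included because the amplitudes in odd uses depend on them; the codes are
  independent of fading, noise and inputs jointly.\<close>

definition channel_gen :: "'w set set" where
  "channel_gen = preimages M (\<lambda>((j, r), b). \<xi> j r b) (edges net i \<times> uses net)
    \<union> preimages M (\<lambda>(r, b). w r b) (UNIV \<times> uses net)
    \<union> preimages M (\<lambda>j \<omega>. state net i j \<omega> $ m) UNIV"

abbreviation "CodeM \<equiv> sigma (space M) code_gen"
abbreviation "ChanM \<equiv> sigma (space M) channel_gen"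

lemma B_pos: "1 \<le> B" and width_pos: "dmin net < dmax net" and power_pos: "0 < tx_power net j"
  using protocol by (simp_all add: protocol_assumptions_def)

lemmas run_channel = channel[unfolded channel_assumptions_def, THEN spec, THEN spec, of i m]

lemma noise_realizations: "\<forall>r. realizations M (noise net i m r) (w r) (uses net)"
  and fading_realizations: "\<forall>r. \<forall>j\<in>nbr r. realizations M (fading net i m j r) (\<xi> j r) (uses net)"
  and noise_integrable: "\<forall>r l. integrable M (\<lambda>\<omega>. (cmod (noise net i m r \<omega>))\<^sup>2 * (cmod (noise net i m l \<omega>))\<^sup>2)"
  and fading_integrable: "\<forall>r l. \<forall>j\<in>nbr r. \<forall>k\<in>nbr l.
    integrable M (\<lambda>\<omega>. (cmod (fading net i m j r \<omega>))\<^sup>2 * (cmod (fading net i m k l \<omega>))\<^sup>2)"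
  and fading_noise_indep: "\<forall>r l. \<forall>j\<in>nbr r. \<forall>b\<in>uses net. \<forall>b'\<in>uses net.
    indep_var borel (\<xi> j r b) borel (w l b')"
  and fading_paired: "\<forall>r. \<forall>j\<in>nbr r. \<forall>b\<in>uses net. odd b \<longrightarrow>
    (AE \<omega> in M. \<xi> j r b \<omega> = \<xi> j r (b + 1) \<omega>)"
proof -
  from run_channel show "\<forall>r. realizations M (noise net i m r) (w r) (uses net)" by (elim conjE)
  from run_channel show "\<forall>r. \<forall>j\<in>nbr r. realizations M (fading net i m j r) (\<xi> j r) (uses net)"
    by (elim conjE)
  from run_channel show "\<forall>r l. integrable M (\<lambda>\<omega>. (cmod (noise net i m r \<omega>))\<^sup>2 * (cmod (noise net i m l \<omega>))\<^sup>2)"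
    by (elim conjE)
  from run_channel show "\<forall>r l. \<forall>j\<in>nbr r. \<forall>k\<in>nbr l.
    integrable M (\<lambda>\<omega>. (cmod (fading net i m j r \<omega>))\<^sup>2 * (cmod (fading net i m k l \<omega>))\<^sup>2)"
    by (elim conjE)
  from run_channel show "\<forall>r l. \<forall>j\<in>nbr r. \<forall>b\<in>uses net. \<forall>b'\<in>uses net.
    indep_var borel (\<xi> j r b) borel (w l b')" by (elim conjE)
  from run_channel show "\<forall>r. \<forall>j\<in>nbr r. \<forall>b\<in>uses net. odd b \<longrightarrow>
    (AE \<omega> in M. \<xi> j r b \<omega> = \<xi> j r (b + 1) \<omega>)" by (elim conjE)
qed

lemma uses_odd: "b \<in> {1..B} \<Longrightarrow> 2 * b - 1 \<in> uses net"
  and uses_even: "b \<in> {1..B} \<Longrightarrow> 2 * b \<in> uses net"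
  by (auto simp: uses_def)

lemma gen_subset_Pow: "code_gen \<subseteq> Pow (space M)" "channel_gen \<subseteq> Pow (space M)"
  by (auto simp: code_gen_def channel_gen_def preimages_def)

lemma measurable_preimages:
  assumes "k \<in> I" and "preimages M X I \<subseteq> G" and "G \<subseteq> Pow (space M)"
  shows "X k \<in> borel_measurable (sigma (space M) G)"
  using assms by (intro measurableI) (auto simp: preimages_def)

lemma code_measurable: "b \<in> uses net \<Longrightarrow> U j b \<in> borel_measurable CodeM"
  using measurable_preimages[OF _ order_refl gen_subset_Pow(1)[unfolded code_gen_def], of "(j, b)"]
  by (simp add: code_gen_def)

lemma fading_measurable:
  assumes "b \<in> uses net" and "j \<in> nbr r"
  shows "\<xi> j r b \<in> borel_measurable ChanM"
proof -
  have "preimages M (\<lambda>((j, r), b). \<xi> j r b) (edges net i \<times> uses net) \<subseteq> channel_gen"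
    unfolding channel_gen_def by blast
  from measurable_preimages[OF _ this gen_subset_Pow(2), of "((j, r), b)"] show ?thesis
    using assms by (simp add: nbrs_def)
qed

lemma noise_measurable:
  assumes "b \<in> uses net"
  shows "w r b \<in> borel_measurable ChanM"
proof -
  have "preimages M (\<lambda>(r, b). w r b) (UNIV \<times> uses net) \<subseteq> channel_gen"
    unfolding channel_gen_def by blast
  from measurable_preimages[OF _ this gen_subset_Pow(2), of "(r, b)"] show ?thesis
    using assms by simp
qed

lemma state_measurable: "(\<lambda>\<omega>. state net i j \<omega> $ m) \<in> borel_measurable ChanM"
proof -
  have "preimages M (\<lambda>j \<omega>. state net i j \<omega> $ m) UNIV \<subseteq> channel_gen"
    unfolding channel_gen_def by blast
  from measurable_preimages[OF _ this gen_subset_Pow(2), of j] show ?thesis by simp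
qed

lemma indep_code_channel: "indep_set (sets CodeM) (sets ChanM)"
  using protocol gen_subset_Pow
  by (simp add: protocol_assumptions_def code_assumptions_def code_gen_def channel_gen_def)

lemma channel_imp_measurable: "X \<in> borel_measurable ChanM \<Longrightarrow> X \<in> borel_measurable M"
  by (erule measurable_from_subalg[rotated])
     (use indep_setD_ev2[OF indep_code_channel] gen_subset_Pow in \<open>simp add: subalgebra_def\<close>)

lemma code_unit: "AE \<omega> in M. \<forall>j. \<forall>b\<in>uses net. cmod (U j b \<omega>) = 1"
proof -
  have "AE \<omega> in M. cmod (U j b \<omega>) = 1" if "b \<in> uses net" for j b
    using protocol that by (simp add: protocol_assumptions_def code_assumptions_def)
  moreover have "finite (uses net)" by (simp add: uses_def)
  ultimately show ?thesis by (simp add: AE_finite_allI AE_all_countable AE_ball_countable countable_finite)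
qed

lemma code_mean: "b \<in> uses net \<Longrightarrow> has_bochner_integral M (U j b) 0"
  using protocol by (simp add: protocol_assumptions_def code_assumptions_def)

text \<open>Codes of different agents in the same use are independent, so the mean factors into two
  zero means.\<close>

lemma code_product_mean:
  assumes b: "b \<in> uses net" and "j \<noteq> k"
  shows "has_bochner_integral M (\<lambda>\<omega>. U j b \<omega> * cnj (U k b \<omega>)) 0"
proof -
  have "indep_vars (\<lambda>_. borel) (\<lambda>(j, b). U j b) (UNIV \<times> uses net)"
    using protocol by (simp add: protocol_assumptions_def code_assumptions_def)
  then have "indep_var borel (U j b) borel (U k b)"
    using indep_vars_imp_indep_var[of borel "\<lambda>(j, b). U j b" "UNIV \<times> uses net" "(j, b)" "(k, b)"] assms
    by simp
  then have "indep_var borel (id \<circ> U j b) borel (cnj \<circ> U k b)"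
    by (rule indep_var_compose) (simp_all add: borel_measurable_cnj)
  then have "has_bochner_integral M (\<lambda>\<omega>. U j b \<omega> * cnj (U k b \<omega>))
      (integral\<^sup>L M (U j b) * integral\<^sup>L M (\<lambda>\<omega>. cnj (U k b \<omega>)))"
    using indep_var_has_integral_mult[of "U j b" "\<lambda>\<omega>. cnj (U k b \<omega>)"] code_mean[OF b]
    by (simp add: comp_def has_bochner_integral_iff)
  then show ?thesis using code_mean[OF b] by (simp add: has_bochner_integral_iff)
qed

text \<open>Independence of the two \<sigma>-algebras factors the mean, and the code factor
  contributes 0. This disposes of every cross term, even after multiplication by a weight.\<close>

lemma channel_code_mean:
  fixes G V :: "'w \<Rightarrow> complex"
  assumes "G \<in> borel_measurable ChanM" and "integrable M G"
    and "V \<in> borel_measurable CodeM" and "has_bochner_integral M V 0"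
  shows "has_bochner_integral M (\<lambda>\<omega>. Re (G \<omega> * V \<omega>)) 0"
proof -
  have "indep_var borel V borel G"
    by (rule indep_var_of_indep_set[where S = CodeM and T = ChanM, OF indep_code_channel])
       (use assms gen_subset_Pow in simp_all)
  from indep_var_has_integral_mult[OF this] have "has_bochner_integral M (\<lambda>\<omega>. V \<omega> * G \<omega>) 0"
    using assms by (simp add: has_bochner_integral_iff)
  from has_bochner_integral_Re[OF this] show ?thesis by (simp add: mult.commute)
qed

section \<open>Moments of noise, fading and weights\<close>

lemma noise_at_distr: "b \<in> uses net \<Longrightarrow> distr M borel (w r b) = distr M borel (noise net i m r)"
  and noise_borel: "noise net i m r \<in> borel_measurable M"
  using noise_realizations by (simp_all add: realizations_def)

text \<open>The mixed-moment assumption with the same receiver taken twice is a fourth moment; the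
  fading is treated likewise.\<close>

lemma noise_moment: "has_moment M 4 (noise net i m r)"
  using noise_integrable[THEN spec, THEN spec, of r r] noise_borel
  by (simp add: has_moment_def power_add[symmetric])

lemma noise_at_moment: "b \<in> uses net \<Longrightarrow> has_moment M 4 (w r b)"
  using has_moment_cong_distr[OF noise_moment] noise_at_distr
    channel_imp_measurable[OF noise_measurable] by blast

lemma fading_at_moment:
  assumes b: "b \<in> uses net" and j: "j \<in> nbr r"
  shows "has_moment M 4 (\<xi> j r b)"
proof -
  let ?X = "fading net i m j r"
  have re: "realizations M ?X (\<xi> j r) (uses net)" using fading_realizations j by blast
  have "has_moment M 4 ?X"
    using fading_integrable[THEN spec, THEN spec, THEN bspec, THEN bspec, OF j j] re
    by (simp add: has_moment_def realizations_def power_add[symmetric])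
  then show ?thesis
    by (rule has_moment_cong_distr) (use re b in \<open>auto simp: realizations_def\<close>)
qed

text \<open>\<open>noise_power\<close> is defined from the nominal variable; the realization in use
  \<open>b\<close> has the same distribution, hence the same mean energy.\<close>

lemma noise_energy_mean:
  assumes b: "b \<in> uses net"
  shows "has_bochner_integral M (\<lambda>\<omega>. (cmod (w r b \<omega>))\<^sup>2 - m\<^sub>w r) 0"
proof -
  have meas: "w r b \<in> borel_measurable M" by (rule channel_imp_measurable[OF noise_measurable[OF b]])
  have "m\<^sub>w r = integral\<^sup>L (distr M borel (noise net i m r)) (\<lambda>z. (cmod z)\<^sup>2)"
    by (simp add: noise_power_def integral_distr noise_borel)
  also have "\<dots> = integral\<^sup>L M (\<lambda>\<omega>. (cmod (w r b \<omega>))\<^sup>2)"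
    unfolding noise_at_distr[OF b, symmetric] by (simp add: integral_distr meas)
  finally have "integral\<^sup>L M (\<lambda>\<omega>. (cmod (w r b \<omega>))\<^sup>2) = m\<^sub>w r" ..
  moreover have "integrable M (\<lambda>\<omega>. (cmod (w r b \<omega>))\<^sup>2)"
    using has_moment_mono[OF noise_at_moment[OF b], of 2] by (simp add: has_moment_def)
  ultimately show ?thesis by (simp add: has_bochner_integral_iff prob_space)
qed

lemma fading_energy_moment:
  assumes "b \<in> uses net" and "j \<in> nbr r"
  shows "has_moment M 2 (\<lambda>\<omega>. (cmod (\<xi> j r b \<omega>))\<^sup>2)"
  using fading_at_moment[OF assms] has_moment_norm_power[of M 2 2] by simp

lemma weight_channel_measurable: "\<nu> j r \<in> borel_measurable ChanM"
proof (cases "j \<in> nbr r")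
  case True
  have [measurable]: "\<xi> j r (2 * b - 1) \<in> borel_measurable ChanM" if "b \<in> {1..B}" for b
    using fading_measurable[OF uses_odd[OF that] True] .
  have "(\<lambda>\<omega>. tx_power net j / real B * (\<Sum>b=1..B. (cmod (\<xi> j r (2 * b - 1) \<omega>))\<^sup>2))
      \<in> borel_measurable ChanM" by measurable
  then show ?thesis using True by (simp add: weight_def[abs_def] nbrs_def)
qed (simp add: weight_def[abs_def] nbrs_def)

lemma weight_moment: "has_moment M 2 (\<nu> j r)"
proof (cases "j \<in> nbr r")
  case True
  have "has_moment M 2 (\<lambda>\<omega>. tx_power net j / real B * (\<Sum>b=1..B. (cmod (\<xi> j r (2 * b - 1) \<omega>))\<^sup>2))"
    by (intro has_moment_scale has_moment_sum fading_energy_moment uses_odd True) simp_all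
  then show ?thesis using True by (simp add: weight_def[abs_def] nbrs_def)
qed (simp add: weight_def[abs_def] nbrs_def has_moment_const)

text \<open>Independence is assumed between one fading and one noise realization at a time, so the
  sum in the weight is treated term by term.\<close>

lemma weight_noise_energy_mean:
  assumes b: "b \<in> uses net"
  shows "has_bochner_integral M (\<lambda>\<omega>. \<nu> j l \<omega> * ((cmod (w r b \<omega>))\<^sup>2 - m\<^sub>w r)) 0"
proof (cases "j \<in> nbr l")
  case True
  have "has_bochner_integral M
      (\<lambda>\<omega>. (cmod (\<xi> j l (2 * b' - 1) \<omega>))\<^sup>2 * ((cmod (w r b \<omega>))\<^sup>2 - m\<^sub>w r)) 0" if "b' \<in> {1..B}" for b'
  proof -
    note b' = uses_odd[OF that]
    have "indep_var borel (\<xi> j l (2 * b' - 1)) borel (w r b)"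
      using fading_noise_indep True b b' by blast
    then have "indep_var borel ((\<lambda>z. (cmod z)\<^sup>2) \<circ> \<xi> j l (2 * b' - 1))
        borel ((\<lambda>z. (cmod z)\<^sup>2 - m\<^sub>w r) \<circ> w r b)"
      by (rule indep_var_compose) measurable
    then have "indep_var borel (\<lambda>\<omega>. (cmod (\<xi> j l (2 * b' - 1) \<omega>))\<^sup>2)
        borel (\<lambda>\<omega>. (cmod (w r b \<omega>))\<^sup>2 - m\<^sub>w r)"
      by (simp add: comp_def)
    moreover have "integrable M (\<lambda>\<omega>. (cmod (\<xi> j l (2 * b' - 1) \<omega>))\<^sup>2)"
      using has_moment_mono[OF fading_energy_moment[OF b' True], of 1] has_moment_1 by simp
    ultimately show ?thesis
      using indep_var_has_integral_mult[of "\<lambda>\<omega>. (cmod (\<xi> j l (2 * b' - 1) \<omega>))\<^sup>2"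
        "\<lambda>\<omega>. (cmod (w r b \<omega>))\<^sup>2 - m\<^sub>w r"] noise_energy_mean[OF b, of r]
      by (simp only: has_bochner_integral_iff) simp
  qed
  then have "has_bochner_integral M (\<lambda>\<omega>. tx_power net j / real B *
      (\<Sum>b'=1..B. (cmod (\<xi> j l (2 * b' - 1) \<omega>))\<^sup>2 * ((cmod (w r b \<omega>))\<^sup>2 - m\<^sub>w r)))
      (tx_power net j / real B * (\<Sum>b'=1..B. 0))"
    by (intro has_bochner_integral_mult_right has_bochner_integral_sum)
  then show ?thesis
    using True by (simp add: weight_def[abs_def] nbrs_def sum_distrib_right sum_distrib_left mult.assoc)
qed (simp add: weight_def[abs_def] nbrs_def has_bochner_integral_zero)

section \<open>The energy error of one channel use\<close>

definition amp :: "'n \<Rightarrow> 'n \<Rightarrow> nat \<Rightarrow> 'w \<Rightarrow> complex" where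
  "amp j r b \<omega> = \<xi> j r b \<omega>
     * complex_of_real (sqrt (pre_scale net j (if odd b then state net i j \<omega> $ m else dmax net)))"

text \<open>What remains of the received energy once the transmitted energies and the mean noise
  energy are removed: cross terms and centred noise energy.\<close>

definition slot_error :: "'n \<Rightarrow> nat \<Rightarrow> 'w \<Rightarrow> real" where
  "slot_error r b \<omega> = (cmod (received net i m r b \<omega>))\<^sup>2 - (\<Sum>j\<in>nbr r. (cmod (amp j r b \<omega>))\<^sup>2) - m\<^sub>w r"

text \<open>Separates each transmission into a coefficient measurable with respect to
  \<open>ChanM\<close> and a code symbol.\<close>

lemma received_amp: "received net i m r b \<omega> = (\<Sum>j\<in>nbr r. amp j r b \<omega> * U j b \<omega>) + w r b \<omega>"
  by (simp add: received_def sent_def amp_def mult.assoc)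

lemma state_range: "AE \<omega> in M. \<forall>j. state net i j \<omega> $ m \<in> {dmin net..dmax net}"
proof -
  have "AE \<omega> in M. state net i j \<omega> $ m \<in> {dmin net..dmax net}" for j
  proof -
    have "AE \<omega> in M. \<forall>m. state net i j \<omega> $ m \<in> {dmin net..dmax net}"
      using protocol unfolding protocol_assumptions_def by blast
    then show ?thesis by eventually_elim blast
  qed
  then show ?thesis by (simp add: AE_all_countable)
qed

lemma pre_scale_bounds:
  assumes "x \<in> {dmin net..dmax net}"
  shows "0 \<le> pre_scale net j x" and "pre_scale net j x \<le> tx_power net j"
proof -
  define t where "t = (x - dmin net) / range_width net"
  have t: "0 \<le> t" "t \<le> 1"
    using assms width_pos by (auto simp: t_def range_width_def field_simps)
  have "pre_scale net j x = tx_power net j * t"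
    by (simp add: pre_scale_def t_def)
  then show "0 \<le> pre_scale net j x" "pre_scale net j x \<le> tx_power net j"
    using t power_pos[of j] by (simp_all add: mult_left_le)
qed

lemma pre_scale_dmax: "pre_scale net j (dmax net) = tx_power net j"
  using width_pos by (simp add: pre_scale_def range_width_def)

lemma amp_measurable:
  assumes [simp]: "b \<in> uses net" "j \<in> nbr r"
  shows "amp j r b \<in> borel_measurable ChanM"
proof -
  have [measurable]: "\<xi> j r b \<in> borel_measurable ChanM" by (simp add: fading_measurable)
  have [measurable]: "(\<lambda>\<omega>. state net i j \<omega> $ m) \<in> borel_measurable ChanM" by (rule state_measurable)
  have [measurable]: "pre_scale net j \<in> borel_measurable borel"
    unfolding pre_scale_def[abs_def] by measurable
  show ?thesis unfolding amp_def[abs_def] by measurable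
qed

lemma cmod_amp_square:
  assumes "x \<in> {dmin net..dmax net}"
  shows "(cmod (z * complex_of_real (sqrt (pre_scale net j x))))\<^sup>2 = pre_scale net j x * (cmod z)\<^sup>2"
  using pre_scale_bounds(1)[OF assms] by (simp add: norm_mult power_mult_distrib)

text \<open>Inputs lie almost surely in the admissible range, so the factor next to the fading is
  bounded by \<open>sqrt (tx_power net j)\<close>.\<close>

lemma amp_moment:
  assumes b: "b \<in> uses net" and j: "j \<in> nbr r"
  shows "has_moment M 4 (amp j r b)"
proof (rule has_moment_dominated[OF fading_at_moment[OF b j]])
  show "amp j r b \<in> borel_measurable M"
    by (rule channel_imp_measurable[OF amp_measurable[OF b j]])
  show "AE \<omega> in M. cmod (amp j r b \<omega>) \<le> sqrt (tx_power net j) * cmod (\<xi> j r b \<omega>)"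
    using state_range
  proof eventually_elim
    case (elim \<omega>)
    let ?x = "if odd b then state net i j \<omega> $ m else dmax net"
    have "?x \<in> {dmin net..dmax net}" using elim width_pos by auto
    then have "\<bar>sqrt (pre_scale net j ?x)\<bar> \<le> sqrt (tx_power net j)"
      using pre_scale_bounds by simp
    then have "cmod (\<xi> j r b \<omega>) * \<bar>sqrt (pre_scale net j ?x)\<bar> \<le> cmod (\<xi> j r b \<omega>) * sqrt (tx_power net j)"
      by (rule mult_left_mono) simp
    then show ?case unfolding amp_def by (simp only: norm_mult norm_of_real mult.commute)
  qed
qed

text \<open>Unit modulus of the codes makes the diagonal energies equal to those subtracted in
  \<open>slot_error\<close>.\<close>

lemma slot_error_expand:
  assumes b: "b \<in> uses net"
  shows "AE \<omega> in M. slot_error r b \<omega> =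
    (\<Sum>j\<in>nbr r. \<Sum>k\<in>nbr r - {j}. Re (amp j r b \<omega> * cnj (amp k r b \<omega>) * (U j b \<omega> * cnj (U k b \<omega>))))
    + 2 * (\<Sum>j\<in>nbr r. Re (amp j r b \<omega> * cnj (w r b \<omega>) * U j b \<omega>)) + ((cmod (w r b \<omega>))\<^sup>2 - m\<^sub>w r)"
  using code_unit
proof eventually_elim
  case (elim \<omega>)
  then have unit: "cmod (U j b \<omega>) = 1" for j using b by blast
  have diag: "(cmod (amp j r b \<omega> * U j b \<omega>))\<^sup>2 = (cmod (amp j r b \<omega>))\<^sup>2" for j
    by (simp add: norm_mult unit)
  have cross: "amp j r b \<omega> * U j b \<omega> * cnj (amp k r b \<omega> * U k b \<omega>) =
      amp j r b \<omega> * cnj (amp k r b \<omega>) * (U j b \<omega> * cnj (U k b \<omega>))" for j k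
    by (simp add: mult_ac)
  have mixed: "amp j r b \<omega> * U j b \<omega> * cnj (w r b \<omega>) = amp j r b \<omega> * cnj (w r b \<omega>) * U j b \<omega>" for j
    by (simp add: mult_ac)
  show ?case
    unfolding slot_error_def received_amp cmod_square_sum_add[OF finite] diag cross mixed by linarith
qed

lemma received_moment:
  assumes b: "b \<in> uses net"
  shows "has_moment M 4 (received net i m r b)"
proof -
  have U: "has_moment M 4 (\<lambda>\<omega>. amp j r b \<omega> * U j b \<omega>)" if j: "j \<in> nbr r" for j
  proof (rule has_moment_dominated[OF amp_moment[OF b j], of _ 1])
    have "U j b \<in> borel_measurable M" using code_mean[OF b] by (rule borel_measurable_has_bochner_integral)
    then show "(\<lambda>\<omega>. amp j r b \<omega> * U j b \<omega>) \<in> borel_measurable M"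
      using channel_imp_measurable[OF amp_measurable[OF b j]] by measurable
    show "AE \<omega> in M. cmod (amp j r b \<omega> * U j b \<omega>) \<le> 1 * cmod (amp j r b \<omega>)"
      using code_unit by eventually_elim (use b in \<open>simp add: norm_mult\<close>)
  qed
  show ?thesis
    unfolding received_amp[abs_def] by (intro has_moment_add has_moment_sum U noise_at_moment b) simp_all
qed

lemma slot_error_moment:
  assumes b: "b \<in> uses net"
  shows "has_moment M 2 (slot_error r b)"
proof -
  have sq: "has_moment M 4 X \<Longrightarrow> has_moment M 2 (\<lambda>\<omega>. (cmod (X \<omega>))\<^sup>2)" for X
    using has_moment_norm_power[of M 2 2 X] by simp
  have "has_moment M 2 (\<lambda>\<omega>. (cmod (received net i m r b \<omega>))\<^sup>2
      + - 1 * (\<Sum>j\<in>nbr r. (cmod (amp j r b \<omega>))\<^sup>2) + - m\<^sub>w r)"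
    by (intro has_moment_add has_moment_scale has_moment_sum has_moment_const sq
      received_moment amp_moment b) simp_all
  then show ?thesis by (simp add: slot_error_def[abs_def])
qed

text \<open>Cross terms vanish by \<open>channel_code_mean\<close>, with \<open>F\<close> absorbed
  into the channel factor. The pure noise term is a hypothesis, because \<open>F\<close> and the
  noise are both measurable with respect to \<open>ChanM\<close> and need not be independent. The
  lemma is applied with \<open>F\<close> equal to 1 and to a weight.\<close>

lemma slot_error_mean:
  assumes b: "b \<in> uses net"
    and F: "F \<in> borel_measurable ChanM" "has_moment M 2 F"
    and noise: "has_bochner_integral M (\<lambda>\<omega>. F \<omega> * ((cmod (w r b \<omega>))\<^sup>2 - m\<^sub>w r)) 0"
  shows "has_bochner_integral M (\<lambda>\<omega>. F \<omega> * slot_error r b \<omega>) 0"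
proof -
  note F(1)[measurable]
  note amp_measurable[OF b, measurable] noise_measurable[OF b, measurable] code_measurable[OF b, measurable]
  have FC: "has_moment M 2 (\<lambda>\<omega>. complex_of_real (F \<omega>))"
    by (rule has_moment_dominated[OF F(2), of _ 1])
       (use has_moment_measurable[OF F(2)] in simp_all)
  have prod: "has_moment M 2 (\<lambda>\<omega>. X \<omega> * cnj (Y \<omega>))"
    if "has_moment M 4 X" and Y: "has_moment M 4 Y" for X Y
  proof -
    have "has_moment M 4 (\<lambda>\<omega>. cnj (Y \<omega>))"
      by (rule has_moment_dominated[OF Y, of _ 1])
         (use has_moment_measurable[OF Y] in simp_all)
    then show ?thesis using has_moment_mult[of M 2 X "\<lambda>\<omega>. cnj (Y \<omega>)"] that(1) by simp
  qed
  \<comment> \<open>\<open>F\<close> has order 2, and so has a product of two variables of order 4;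
    hence the triple product is integrable.\<close>
  have G: "integrable M (\<lambda>\<omega>. complex_of_real (F \<omega>) * (X \<omega> * cnj (Y \<omega>)))"
    if "has_moment M 4 X" "has_moment M 4 Y" for X Y
    by (rule integrable_mult_square_moment[OF FC prod[OF that]])
  have cross: "has_bochner_integral M (\<lambda>\<omega>. F \<omega> *
      Re (amp j r b \<omega> * cnj (amp k r b \<omega>) * (U j b \<omega> * cnj (U k b \<omega>)))) 0"
    if jk: "j \<in> nbr r" "k \<in> nbr r - {j}" for j k
  proof -
    have k: "k \<in> nbr r" "j \<noteq> k" using jk by auto
    have "has_bochner_integral M (\<lambda>\<omega>. Re (complex_of_real (F \<omega>) * (amp j r b \<omega> * cnj (amp k r b \<omega>))
        * (U j b \<omega> * cnj (U k b \<omega>)))) 0"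
    proof (rule channel_code_mean)
      show "(\<lambda>\<omega>. complex_of_real (F \<omega>) * (amp j r b \<omega> * cnj (amp k r b \<omega>))) \<in> borel_measurable ChanM"
        using jk(1) k(1) by measurable
      show "(\<lambda>\<omega>. U j b \<omega> * cnj (U k b \<omega>)) \<in> borel_measurable CodeM" by measurable
    qed (intro G amp_moment b jk k code_product_mean)+
    then show ?thesis by (simp only: mult.assoc Re_of_real_mult)
  qed
  have mixed: "has_bochner_integral M (\<lambda>\<omega>. F \<omega> * Re (amp j r b \<omega> * cnj (w r b \<omega>) * U j b \<omega>)) 0"
    if j: "j \<in> nbr r" for j
  proof -
    have "has_bochner_integral M (\<lambda>\<omega>. Re (complex_of_real (F \<omega>) * (amp j r b \<omega> * cnj (w r b \<omega>))
        * U j b \<omega>)) 0"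
    proof (rule channel_code_mean)
      show "(\<lambda>\<omega>. complex_of_real (F \<omega>) * (amp j r b \<omega> * cnj (w r b \<omega>))) \<in> borel_measurable ChanM"
        using j by measurable
    qed (intro G amp_moment noise_at_moment b j code_mean code_measurable)+
    then show ?thesis by (simp only: mult.assoc Re_of_real_mult)
  qed
  have "has_bochner_integral M (\<lambda>\<omega>.
      (\<Sum>j\<in>nbr r. \<Sum>k\<in>nbr r - {j}. F \<omega> *
        Re (amp j r b \<omega> * cnj (amp k r b \<omega>) * (U j b \<omega> * cnj (U k b \<omega>))))
      + 2 * (\<Sum>j\<in>nbr r. F \<omega> * Re (amp j r b \<omega> * cnj (w r b \<omega>) * U j b \<omega>))
      + F \<omega> * ((cmod (w r b \<omega>))\<^sup>2 - m\<^sub>w r))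
    ((\<Sum>j\<in>nbr r. \<Sum>k\<in>nbr r - {j}. 0) + 2 * (\<Sum>j\<in>nbr r. 0) + 0)"
    by (intro has_bochner_integral_add has_bochner_integral_sum has_bochner_integral_mult_right
      cross mixed noise)
  then have "has_bochner_integral M (\<lambda>\<omega>. F \<omega> *
     ((\<Sum>j\<in>nbr r. \<Sum>k\<in>nbr r - {j}. Re (amp j r b \<omega> * cnj (amp k r b \<omega>) * (U j b \<omega> * cnj (U k b \<omega>))))
    + 2 * (\<Sum>j\<in>nbr r. Re (amp j r b \<omega> * cnj (w r b \<omega>) * U j b \<omega>)) + ((cmod (w r b \<omega>))\<^sup>2 - m\<^sub>w r))) 0"
    (is "has_bochner_integral M ?E 0")
    by (simp add: sum_distrib_left distrib_left mult.left_commute[of 2])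
  \<comment> \<open>The expansion holds only almost everywhere, so measurability of the product is
    supplied separately.\<close>
  moreover have "(\<lambda>\<omega>. F \<omega> * slot_error r b \<omega>) \<in> borel_measurable M"
    using channel_imp_measurable[OF F(1)] has_moment_measurable[OF slot_error_moment[OF b]] by measurable
  moreover have "AE \<omega> in M. F \<omega> * slot_error r b \<omega> = ?E \<omega>"
    using slot_error_expand[OF b, of r] by eventually_elim simp
  ultimately show ?thesis
    using has_bochner_integral_cong_AE has_bochner_integral_iff borel_measurable_has_bochner_integral
    by blast
qed

text \<open>Collects what the model needs of an error. As entries of \<open>P_check\<close> within a
  coordinate are affine in the weights, the last two conditions make the error uncorrelated with
  them. The class is closed under linear combinations, which reduces the protocol errors to slot
  errors.\<close>

definition centred :: "('w \<Rightarrow> real) \<Rightarrow> bool" where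
  "centred e \<longleftrightarrow> has_moment M 2 e \<and> has_bochner_integral M e 0 \<and>
     (\<forall>j l. has_bochner_integral M (\<lambda>\<omega>. \<nu> j l \<omega> * e \<omega>) 0)"

lemma centred_add:
  assumes "centred e" "centred f"
  shows "centred (\<lambda>\<omega>. e \<omega> + f \<omega>)"
  unfolding centred_def
proof (intro conjI allI)
  show "has_moment M 2 (\<lambda>\<omega>. e \<omega> + f \<omega>)"
    using assms by (intro has_moment_add) (simp_all add: centred_def)
  have "has_bochner_integral M (\<lambda>\<omega>. e \<omega> + f \<omega>) (0 + 0)"
    using assms by (intro has_bochner_integral_add) (simp_all add: centred_def)
  then show "has_bochner_integral M (\<lambda>\<omega>. e \<omega> + f \<omega>) 0" by simp
  have "has_bochner_integral M (\<lambda>\<omega>. \<nu> j l \<omega> * e \<omega> + \<nu> j l \<omega> * f \<omega>) (0 + 0)" for j l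
    using assms by (intro has_bochner_integral_add) (simp_all add: centred_def)
  then show "has_bochner_integral M (\<lambda>\<omega>. \<nu> j l \<omega> * (e \<omega> + f \<omega>)) 0" for j l
    by (simp add: distrib_left)
qed

lemma centred_scale:
  assumes "centred e"
  shows "centred (\<lambda>\<omega>. c * e \<omega>)"
  unfolding centred_def
proof (intro conjI allI)
  show "has_moment M 2 (\<lambda>\<omega>. c * e \<omega>)"
    using assms by (intro has_moment_scale) (simp add: centred_def)
  have "has_bochner_integral M (\<lambda>\<omega>. c * e \<omega>) (c * 0)"
    using assms by (intro has_bochner_integral_mult_right) (simp add: centred_def)
  then show "has_bochner_integral M (\<lambda>\<omega>. c * e \<omega>) 0" by simp
  have "has_bochner_integral M (\<lambda>\<omega>. c * (\<nu> j l \<omega> * e \<omega>)) (c * 0)" for j l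
    using assms by (intro has_bochner_integral_mult_right) (simp add: centred_def)
  then show "has_bochner_integral M (\<lambda>\<omega>. \<nu> j l \<omega> * (c * e \<omega>)) 0" for j l
    by (simp add: mult.left_commute)
qed

lemma centred_zero: "centred (\<lambda>_. 0)"
  by (simp add: centred_def has_moment_zero has_bochner_integral_zero)

lemma centred_sum: "(\<And>k. k \<in> K \<Longrightarrow> centred (e k)) \<Longrightarrow> centred (\<lambda>\<omega>. \<Sum>k\<in>K. e k \<omega>)"
  by (induction K rule: infinite_finite_induct) (simp_all add: centred_zero centred_add)

lemma centred_cong_AE:
  assumes e: "centred e" and f: "f \<in> borel_measurable M" and eq: "AE \<omega> in M. f \<omega> = e \<omega>"
  shows "centred f"
  unfolding centred_def
proof (intro conjI allI)
  have mom: "has_moment M 2 e" and mean: "has_bochner_integral M e 0"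
    and wm: "has_bochner_integral M (\<lambda>\<omega>. \<nu> j l \<omega> * e \<omega>) 0" for j l
    using e by (auto simp: centred_def)
  show "has_moment M 2 f"
    by (rule has_moment_dominated[OF mom f, of 1]) (use eq in eventually_elim, simp)
  show "has_bochner_integral M f 0"
    using mean has_bochner_integral_cong_AE[OF f has_moment_measurable[OF mom] eq] by simp
  fix j l
  have "(\<lambda>\<omega>. \<nu> j l \<omega> * f \<omega>) \<in> borel_measurable M"
    using has_moment_measurable[OF weight_moment] f by measurable
  moreover have "(\<lambda>\<omega>. \<nu> j l \<omega> * e \<omega>) \<in> borel_measurable M"
    using has_moment_measurable[OF weight_moment] has_moment_measurable[OF mom] by measurable
  moreover have "AE \<omega> in M. \<nu> j l \<omega> * f \<omega> = \<nu> j l \<omega> * e \<omega>"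
    using eq by eventually_elim simp
  ultimately show "has_bochner_integral M (\<lambda>\<omega>. \<nu> j l \<omega> * f \<omega>) 0"
    using wm has_bochner_integral_cong_AE by blast
qed

lemma centred_slot_error:
  assumes b: "b \<in> uses net"
  shows "centred (slot_error r b)"
  unfolding centred_def
proof (intro conjI allI)
  show "has_moment M 2 (slot_error r b)" by (rule slot_error_moment[OF b])
  have "has_bochner_integral M (\<lambda>\<omega>. 1 * slot_error r b \<omega>) 0"
    by (rule slot_error_mean[OF b])
       (use noise_energy_mean[OF b] in \<open>simp_all add: has_moment_const\<close>)
  then show "has_bochner_integral M (slot_error r b) 0" by simp
  show "has_bochner_integral M (\<lambda>\<omega>. \<nu> j l \<omega> * slot_error r b \<omega>) 0" for j l
    by (rule slot_error_mean[OF b weight_channel_measurable weight_moment weight_noise_energy_mean[OF b]])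
qed

section \<open>Protocol errors as sums of slot errors\<close>

lemma fading_even:
  "AE \<omega> in M. \<forall>r. \<forall>j\<in>nbr r. \<forall>b\<in>{1..B}. \<xi> j r (2 * b) \<omega> = \<xi> j r (2 * b - 1) \<omega>"
proof -
  have "AE \<omega> in M. \<xi> j r (2 * b) \<omega> = \<xi> j r (2 * b - 1) \<omega>" if "j \<in> nbr r" "b \<in> {1..B}" for r j b
  proof -
    \<comment> \<open>Since \<open>b\<close> is at least 1, the natural subtraction is genuine and
      the uses \<open>2 * b - 1\<close> and \<open>2 * b\<close> form a pair with equal
      fading.\<close>
    have "odd (2 * b - 1)" and "2 * b - 1 + 1 = 2 * b" using that(2) by auto
    then have "AE \<omega> in M. \<xi> j r (2 * b - 1) \<omega> = \<xi> j r (2 * b) \<omega>"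
      using fading_paired that uses_odd by metis
    then show ?thesis by eventually_elim simp
  qed
  then show ?thesis
    by (simp add: AE_all_countable AE_ball_countable countable_finite)
qed

text \<open>In even uses every agent sends at \<open>dmax\<close>, where \<open>pre_scale\<close> is
  the full power. Equal fading within a pair of uses turns these energies into the weights, which
  are defined from odd uses.\<close>

lemma even_errors:
  "AE \<omega> in M. err' M net i m r \<omega> = 1 / real B * (\<Sum>b=1..B. slot_error r (2 * b) \<omega>)"
  using fading_even
proof eventually_elim
  case (elim \<omega>)
  have "(\<Sum>j\<in>nbr r. \<nu> j r \<omega>) = 1 / real B * (\<Sum>b=1..B. \<Sum>j\<in>nbr r. (cmod (amp j r (2 * b) \<omega>))\<^sup>2)"
  proof -
    have "\<nu> j r \<omega> = 1 / real B * (\<Sum>b=1..B. (cmod (amp j r (2 * b) \<omega>))\<^sup>2)" if j: "j \<in> nbr r" for j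
    proof -
      have "(cmod (amp j r (2 * b) \<omega>))\<^sup>2 = tx_power net j * (cmod (\<xi> j r (2 * b - 1) \<omega>))\<^sup>2"
        if "b \<in> {1..B}" for b
        using elim j that cmod_amp_square[of "dmax net"] width_pos by (simp add: amp_def pre_scale_dmax)
      then show ?thesis
        using j by (simp add: weight_def nbrs_def sum_distrib_left)
    qed
    then show ?thesis by (subst sum.swap) (simp add: sum_distrib_left)
  qed
  then show ?case
    using B_pos
    by (simp add: err'_def v_hat'_def even_energy_def slot_error_def sum_subtractf right_diff_distrib
      diff_divide_distrib)
qed

text \<open>In odd uses, \<open>range_width\<close> times \<open>pre_scale\<close> is the power
  times \<open>state - dmin\<close>, so the energies yield the weighted sum of the inputs shifted by
  \<open>dmin\<close>. The term with \<open>v_hat'\<close> undoes the shift and thereby brings in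
  \<open>err'\<close>.\<close>

lemma all_errors:
  "AE \<omega> in M. err M net i m r \<omega> =
    range_width net / real B * (\<Sum>b=1..B. slot_error r (2 * b - 1) \<omega>) + dmin net * err' M net i m r \<omega>"
  using state_range
proof eventually_elim
  case (elim \<omega>)
  let ?x = "\<lambda>j. state net i j \<omega> $ m"
  have "(\<Sum>j\<in>nbr r. \<nu> j r \<omega> * (?x j - dmin net)) =
    range_width net / real B * (\<Sum>b=1..B. \<Sum>j\<in>nbr r. (cmod (amp j r (2 * b - 1) \<omega>))\<^sup>2)"
  proof -
    have "\<nu> j r \<omega> * (?x j - dmin net) =
      range_width net / real B * (\<Sum>b=1..B. (cmod (amp j r (2 * b - 1) \<omega>))\<^sup>2)" if j: "j \<in> nbr r" for j
    proof -
      have "range_width net * (cmod (amp j r (2 * b - 1) \<omega>))\<^sup>2 =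
        tx_power net j * (?x j - dmin net) * (cmod (\<xi> j r (2 * b - 1) \<omega>))\<^sup>2" if "b \<in> {1..B}" for b
      proof -
        have "odd (2 * b - 1)" using that by auto
        then have "(cmod (amp j r (2 * b - 1) \<omega>))\<^sup>2 =
          pre_scale net j (?x j) * (cmod (\<xi> j r (2 * b - 1) \<omega>))\<^sup>2"
          using elim cmod_amp_square by (simp add: amp_def)
        then show ?thesis using width_pos by (simp add: pre_scale_def range_width_def)
      qed
      then have "(\<Sum>b=1..B. range_width net * (cmod (amp j r (2 * b - 1) \<omega>))\<^sup>2) =
        (\<Sum>b=1..B. tx_power net j * (?x j - dmin net) * (cmod (\<xi> j r (2 * b - 1) \<omega>))\<^sup>2)"
        by (rule sum.cong[OF refl])
      then have "range_width net * (\<Sum>b=1..B. (cmod (amp j r (2 * b - 1) \<omega>))\<^sup>2) =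
        tx_power net j * (?x j - dmin net) * (\<Sum>b=1..B. (cmod (\<xi> j r (2 * b - 1) \<omega>))\<^sup>2)"
        by (simp only: sum_distrib_left)
      then show ?thesis using j by (simp add: weight_def nbrs_def)
    qed
    then show ?thesis by (subst sum.swap) (simp add: sum_distrib_left)
  qed
  then have "(\<Sum>j\<in>nbr r. \<nu> j r \<omega> * ?x j) = dmin net * (\<Sum>j\<in>nbr r. \<nu> j r \<omega>) +
    range_width net / real B * (\<Sum>b=1..B. \<Sum>j\<in>nbr r. (cmod (amp j r (2 * b - 1) \<omega>))\<^sup>2)"
    by (simp add: right_diff_distrib sum_subtractf sum_distrib_left mult.commute)
  then show ?case
    using B_pos
    by (simp add: err_def err'_def v_hat_def odd_energy_def slot_error_def sum_subtractf
      right_diff_distrib diff_divide_distrib)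
qed

lemma errors_measurable:
  "err M net i m r \<in> borel_measurable M" "err' M net i m r \<in> borel_measurable M"
proof -
  have [measurable]: "received net i m r (2 * b) \<in> borel_measurable M" if "b \<in> {1..B}" for b
    by (rule has_moment_measurable[OF received_moment[OF uses_even[OF that]]])
  have [measurable]: "received net i m r (2 * b - 1) \<in> borel_measurable M" if "b \<in> {1..B}" for b
    by (rule has_moment_measurable[OF received_moment[OF uses_odd[OF that]]])
  have [measurable]: "\<nu> j l \<in> borel_measurable M" for j l by (rule has_moment_measurable[OF weight_moment])
  have [measurable]: "(\<lambda>\<omega>. state net i j \<omega> $ m) \<in> borel_measurable M" for j
    by (rule channel_imp_measurable[OF state_measurable])
  show "err M net i m r \<in> borel_measurable M" "err' M net i m r \<in> borel_measurable M"
    unfolding err_def[abs_def] err'_def[abs_def] v_hat_def v_hat'_def odd_energy_def even_energy_def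
    by measurable
qed

lemma centred_err': "centred (err' M net i m r)"
  by (rule centred_cong_AE[OF _ errors_measurable(2) even_errors])
     (intro centred_scale centred_sum centred_slot_error uses_even)

lemma centred_err: "centred (err M net i m r)"
  by (rule centred_cong_AE[OF _ errors_measurable(1) all_errors])
     (intro centred_add centred_scale centred_sum centred_slot_error centred_err' uses_odd)

end

subsection \<open>The information-exchange model\<close>

lemma P_check_nth: "P_check net i \<omega> $ (p, k) $ (q, l) =
  (if k = l then if p = q then 1 - gamma net i * (\<Sum>j\<in>nbrs net i p. weight net i k j p \<omega>)
     else if (p, q) \<in> edges net i then gamma net i * weight net i k q p \<omega> else 0
   else 0)"
  by (simp add: P_check_def block_matrix_def Z_mat_def Diag_def mat_def)

lemma W_check_nth:
  "W_check M net i \<omega> $ a $ b = (if a = b then - gamma net i * err' M net i (snd a) (fst a) \<omega> else 0)"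
  by (simp add: W_check_def Diag_def stack_def n_acute_def)

lemma n_check_nth: "n_check M net i \<omega> $ a = gamma net i * err M net i (snd a) (fst a) \<omega>"
  by (simp add: n_check_def stack_def n_tilde_def)

lemma sum_pairs: "(\<Sum>a\<in>UNIV. f a) = (\<Sum>q\<in>UNIV. \<Sum>l\<in>UNIV. f (q, l))"
  for f :: "'a::finite \<times> 'b::finite \<Rightarrow> 'c::comm_monoid_add"
  by (simp add: sum.cartesian_product)

context ota_run
begin

lemma P_check_moment: "has_moment M 2 (\<lambda>\<omega>. P_check net i \<omega> $ (p, m) $ (q, m))"
proof -
  have "has_moment M 2 (\<lambda>\<omega>. 1 + - gamma net i * (\<Sum>j\<in>nbr p. \<nu> j p \<omega>))"
    by (intro has_moment_add has_moment_const has_moment_scale has_moment_sum weight_moment) simp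
  then show ?thesis
    by (cases "p = q"; cases "(p, q) \<in> edges net i")
       (simp_all add: P_check_nth has_moment_zero has_moment_scale weight_moment)
qed

lemma P_check_centred:
  assumes "centred e"
  shows "has_bochner_integral M (\<lambda>\<omega>. P_check net i \<omega> $ (p, m) $ (q, m) * e \<omega>) 0"
proof -
  have e: "has_bochner_integral M e 0" and we: "has_bochner_integral M (\<lambda>\<omega>. \<nu> j l \<omega> * e \<omega>) 0" for j l
    using assms by (auto simp: centred_def)
  have "has_bochner_integral M (\<lambda>\<omega>. e \<omega> - gamma net i * (\<Sum>j\<in>nbr p. \<nu> j p \<omega> * e \<omega>))
      (0 - gamma net i * (\<Sum>j\<in>nbr p. 0))"
    by (intro has_bochner_integral_diff has_bochner_integral_mult_right has_bochner_integral_sum e we)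
  moreover have "has_bochner_integral M (\<lambda>\<omega>. gamma net i * (\<nu> q p \<omega> * e \<omega>)) (gamma net i * 0)"
    by (intro has_bochner_integral_mult_right we)
  ultimately show ?thesis
    by (cases "p = q"; cases "(p, q) \<in> edges net i")
       (simp_all add: P_check_nth has_bochner_integral_zero left_diff_distrib sum_distrib_right mult.assoc)
qed

end

text \<open>One time with all its coordinates, each of which contributes a scalar run through the
  sublocale.\<close>

locale ota_step = prob_space M for M :: "'w measure" +
  fixes net :: "('w, 'n::finite, 'm::finite) network" and i :: nat
  assumes protocol: "protocol_assumptions M net" and channel: "channel_assumptions M net"
    and network: "network_assumptions M net"
begin

sublocale run: ota_run M net i m for m
  by unfold_locales (fact protocol channel)+

abbreviation "\<gamma> \<equiv> gamma net i"
abbreviation "P \<equiv> P_check net i"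
abbreviation "W \<equiv> W_check M net i"
abbreviation "n \<equiv> n_check M net i"

section \<open>Moments, means and correlations of the model\<close>

lemma P_moment: "has_moment M 2 (\<lambda>\<omega>. P \<omega> $ a $ b)"
proof (cases "snd a = snd b")
  case True
  then show ?thesis
    using run.P_check_moment[of "fst a" "snd a" "fst b"] by (metis prod.collapse)
next
  case False
  then show ?thesis by (cases a; cases b) (simp add: P_check_nth has_moment_zero)
qed

lemma err_moment: "has_moment M 2 (err M net i k r)" and err'_moment: "has_moment M 2 (err' M net i k r)"
  using run.centred_err[of k r] run.centred_err'[of k r] by (simp_all add: run.centred_def)

lemma W_moment: "has_moment M 2 (\<lambda>\<omega>. W \<omega> $ a $ b)"
proof -
  have "has_moment M 2 (\<lambda>\<omega>. - \<gamma> * err' M net i (snd a) (fst a) \<omega>)"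
    by (intro has_moment_scale err'_moment)
  then show ?thesis by (cases "a = b") (simp_all add: W_check_nth has_moment_zero)
qed

lemma n_moment: "has_moment M 2 (\<lambda>\<omega>. n \<omega> $ a)"
  unfolding n_check_nth by (intro has_moment_scale err_moment)

lemma W_mean: "has_bochner_integral M W 0"
proof (intro has_bochner_integral_vec)
  fix a b
  have "has_bochner_integral M (\<lambda>\<omega>. - \<gamma> * err' M net i (snd a) (fst a) \<omega>) (- \<gamma> * 0)"
    using run.centred_err'[of "snd a" "fst a"]
    by (intro has_bochner_integral_mult_right) (simp add: run.centred_def)
  then show "has_bochner_integral M (\<lambda>\<omega>. W \<omega> $ a $ b) (0 $ a $ b)"
    by (cases "a = b") (simp_all add: W_check_nth has_bochner_integral_zero)
qed

lemma n_mean: "has_bochner_integral M n 0"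
proof (intro has_bochner_integral_vec)
  fix a
  have "has_bochner_integral M (\<lambda>\<omega>. \<gamma> * err M net i (snd a) (fst a) \<omega>) (\<gamma> * 0)"
    using run.centred_err[of "snd a" "fst a"]
    by (intro has_bochner_integral_mult_right) (simp add: run.centred_def)
  then show "has_bochner_integral M (\<lambda>\<omega>. n \<omega> $ a) (0 $ a)"
    by (simp add: n_check_nth)
qed

text \<open>Entries of \<open>P\<close> couple only equal coordinates, so every product stays within one scalar run.\<close>

lemma P_uncorrelated:
  assumes "run.centred (snd c) e"
  shows "has_bochner_integral M (\<lambda>\<omega>. P \<omega> $ c $ a * (g * e \<omega>)) 0"
proof (cases "snd c = snd a")
  case True
  then have "has_bochner_integral M (\<lambda>\<omega>. g * (P \<omega> $ c $ a * e \<omega>)) (g * 0)"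
    using run.P_check_centred[OF assms, of "fst c" "fst a"]
    by (intro has_bochner_integral_mult_right) (metis prod.collapse)
  then show ?thesis by (simp add: mult.left_commute)
next
  case False
  then show ?thesis by (cases a; cases c) (simp add: P_check_nth has_bochner_integral_zero)
qed

lemma PW_mean: "has_bochner_integral M (\<lambda>\<omega>. transpose (P \<omega>) ** W \<omega>) 0"
proof (intro has_bochner_integral_vec)
  fix a b
  \<comment> \<open>\<open>W\<close> is diagonal, so only \<open>c = b\<close> contributes, with an
    error from the run of coordinate \<open>snd c\<close>.\<close>
  have "has_bochner_integral M (\<lambda>\<omega>. P \<omega> $ c $ a * W \<omega> $ c $ b) 0" for c
  proof (cases "c = b")
    case True
    then show ?thesis
      using P_uncorrelated[OF run.centred_err'[of "snd c" "fst c"], of a "- \<gamma>"] by (simp add: W_check_nth)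
  qed (simp add: W_check_nth has_bochner_integral_zero)
  then have "has_bochner_integral M (\<lambda>\<omega>. \<Sum>c\<in>UNIV. P \<omega> $ c $ a * W \<omega> $ c $ b) (\<Sum>c\<in>(UNIV :: ('n \<times> 'm) set). 0)"
    by (intro has_bochner_integral_sum)
  then show "has_bochner_integral M (\<lambda>\<omega>. (transpose (P \<omega>) ** W \<omega>) $ a $ b) (0 $ a $ b)"
    by (simp add: transpose_mult_nth)
qed

lemma Pn_mean: "has_bochner_integral M (\<lambda>\<omega>. transpose (P \<omega>) *v n \<omega>) 0"
proof (intro has_bochner_integral_vec)
  fix a
  have "has_bochner_integral M (\<lambda>\<omega>. P \<omega> $ c $ a * n \<omega> $ c) 0" for c
    using P_uncorrelated[OF run.centred_err[of "snd c" "fst c"], of a \<gamma>] by (simp add: n_check_nth)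
  then have "has_bochner_integral M (\<lambda>\<omega>. \<Sum>c\<in>UNIV. P \<omega> $ c $ a * n \<omega> $ c) (\<Sum>c\<in>(UNIV :: ('n \<times> 'm) set). 0)"
    by (intro has_bochner_integral_sum)
  then show "has_bochner_integral M (\<lambda>\<omega>. (transpose (P \<omega>) *v n \<omega>) $ a) (0 $ a)"
    unfolding transpose_vector_mult_nth by simp
qed

text \<open>Off-diagonal blocks ask for the edge \<open>(p, q)\<close>, whereas the diagonal block
  sums over edges \<open>(q, p)\<close>. The two match, and rows sum to 1, once one-way edges have
  weight 0, which holds almost surely.\<close>

lemma consensus_AE: "AE \<omega> in M. \<forall>v\<in>consensus_subspace. P \<omega> *v v = v"
proof -
  have "AE \<omega> in M. \<forall>r j m. (r, j) \<notin> edges net i \<longrightarrow> weight net i m j r \<omega> = 0"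
    using one_way_weight_zero[OF channel protocol network]
    by (simp add: AE_all_countable AE_finite_allI)
  then show ?thesis
  proof eventually_elim
    case (elim \<omega>)
    have irr: "(r, r) \<notin> edges net i" for r using protocol by (auto simp: protocol_assumptions_def)
    show ?case
    proof
      fix v :: "real^('n \<times> 'm)" assume "v \<in> consensus_subspace"
      then obtain f where f: "v = stack f" "\<forall>r s. f r = f s"
        by (auto simp: consensus_subspace_def)
      \<comment> \<open>All blocks of \<open>f\<close> agree, so \<open>undefined\<close> merely
        names some agent.\<close>
      define h where "h = f undefined"
      have h: "v $ (q, l) = h $ l" for q l
        using f(2)[rule_format, of q undefined] by (simp add: f(1) stack_def h_def)
      have "(P \<omega> *v v) $ (p, k) = v $ (p, k)" for p k
      proof -
        have "(P \<omega> *v v) $ (p, k) = (\<Sum>q\<in>UNIV. \<Sum>l\<in>UNIV. P \<omega> $ (p, k) $ (q, l) * h $ l)"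
          by (simp only: matrix_vector_component sum_pairs h)
        also have "\<dots> = (\<Sum>q\<in>UNIV. P \<omega> $ (p, k) $ (q, k)) * h $ k"
        proof -
          have "(\<Sum>l\<in>UNIV. P \<omega> $ (p, k) $ (q, l) * h $ l) =
              (\<Sum>l\<in>UNIV. if l = k then P \<omega> $ (p, k) $ (q, k) * h $ k else 0)" for q
            by (rule sum.cong[OF refl]) (simp add: P_check_nth)
          then show ?thesis by (simp add: sum_distrib_right)
        qed
        also have "(\<Sum>q\<in>UNIV. P \<omega> $ (p, k) $ (q, k)) =
          (\<Sum>q\<in>UNIV. (if q = p then 1 - \<gamma> * (\<Sum>j\<in>nbrs net i p. weight net i k j p \<omega>) else 0)
            + (if q \<in> nbrs net i p then \<gamma> * weight net i k q p \<omega> else 0))"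
        proof (intro sum.cong refl)
          fix q
          have "weight net i k q p \<omega> = 0" if "q \<notin> nbrs net i p"
            using that by (simp add: weight_def nbrs_def)
          then show "P \<omega> $ (p, k) $ (q, k) = (if q = p then 1 - \<gamma> * (\<Sum>j\<in>nbrs net i p. weight net i k j p \<omega>) else 0)
            + (if q \<in> nbrs net i p then \<gamma> * weight net i k q p \<omega> else 0)"
            using elim irr by (auto simp: P_check_nth nbrs_def)
        qed
        also have "\<dots> = 1" by (simp add: sum.distrib sum.If_cases sum_distrib_left)
        finally show ?thesis by (simp add: h)
      qed
      then show "P \<omega> *v v = v" by (metis vec_eq_iff prod.exhaust)
    qed
  qed
qed

section \<open>The expected matrix and its spectral gap\<close>

abbreviation "E k j r \<equiv> expected_weight M net i k j r"

lemma E_nonneg: "0 \<le> E k j r"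
  unfolding expected_weight_def weight_def
  by (intro integral_nonneg_AE AE_I2)
     (auto intro!: sum_nonneg mult_nonneg_nonneg divide_nonneg_nonneg less_imp_le[OF run.power_pos])

lemma E_non_edge: "(j, r) \<notin> edges net i \<Longrightarrow> E k j r = 0"
  by (simp add: expected_weight_def weight_def[abs_def])

text \<open>Reciprocity is assumed on edges; if neither direction is an edge, both expectations are
  0.\<close>

lemma E_sym: "E k j r = E k r j"
proof -
  have "E k j r = E k r j" if "(j, r) \<in> edges net i" for j r
    using network that unfolding network_assumptions_def by blast
  then show ?thesis using E_non_edge by metis
qed

lemma E_loop: "E k r r = 0"
  using protocol by (intro E_non_edge) (simp add: protocol_assumptions_def)

lemma nbrs_sum_E: "(\<Sum>j\<in>nbrs net i r. E k j r) = (\<Sum>j\<in>UNIV. E k j r)"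
  by (rule sum.mono_neutral_left) (auto simp: nbrs_def E_non_edge)

lemma gamma_pos: "0 < \<gamma>"
  using protocol by (simp add: protocol_assumptions_def)

text \<open>Here the bound on \<open>gamma\<close> enters; it keeps the diagonal of the expected
  matrix nonnegative.\<close>

lemma gamma_degree: "\<gamma> * (\<Sum>j\<in>UNIV. E k j r) \<le> 1"
proof -
  define d where "d = (MAX r. \<Sum>j\<in>nbrs net i r. E k j r)"
  have d: "0 < d" "\<gamma> \<le> inverse d"
    using protocol by (simp_all add: protocol_assumptions_def d_def Let_def)
  have "(\<Sum>j\<in>UNIV. E k j r) \<le> d"
    unfolding d_def nbrs_sum_E by (rule Max_ge) simp_all
  then have "\<gamma> * (\<Sum>j\<in>UNIV. E k j r) \<le> inverse d * d"
    using d by (intro mult_mono sum_nonneg E_nonneg) simp_all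
  then show ?thesis using d by simp
qed

lemma P_integrable: "integrable M P"
  by (intro integrable_vec has_moment_1 has_moment_mono[OF P_moment]) simp

abbreviation "Pbar \<equiv> integral\<^sup>L M P"

text \<open>The edge test of \<open>P_check\<close> disappears in the mean: loops and non-edges have
  expected weight 0, and symmetry covers edges without a reverse.\<close>

lemma Pbar_nth: "Pbar $ (p, k) $ (q, l) =
  (if k = l then (if p = q then 1 - \<gamma> * (\<Sum>j\<in>UNIV. E k j p) else 0) + \<gamma> * E k q p else 0)"
proof -
  have w: "integrable M (weight net i k j r)" for j r by (rule integrable_weight[OF channel])
  have diag: "integral\<^sup>L M (\<lambda>\<omega>. 1 - \<gamma> * (\<Sum>j\<in>nbrs net i p. weight net i k j p \<omega>)) =
      1 - \<gamma> * (\<Sum>j\<in>nbrs net i p. E k j p)"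
  proof -
    have "integrable M (\<lambda>\<omega>. \<Sum>j\<in>nbrs net i p. weight net i k j p \<omega>)"
      by (intro Bochner_Integration.integrable_sum w)
    then show ?thesis
      by (simp add: prob_space Bochner_Integration.integral_sum w expected_weight_def)
  qed
  have "Pbar $ (p, k) $ (q, l) = integral\<^sup>L M (\<lambda>\<omega>. P \<omega> $ (p, k) $ (q, l))"
    by (simp add: integral_vec_nth integrable_vec_nth P_integrable)
  also have "\<dots> = (if k = l then if p = q then 1 - \<gamma> * (\<Sum>j\<in>nbrs net i p. E k j p)
      else if (p, q) \<in> edges net i then \<gamma> * E k q p else 0 else 0)"
    using diag by (cases "p = q"; cases "k = l") (auto simp: P_check_nth expected_weight_def)
  also have "\<dots> = (if k = l then (if p = q then 1 - \<gamma> * (\<Sum>j\<in>UNIV. E k j p) else 0) + \<gamma> * E k q p else 0)"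
    unfolding nbrs_sum_E using E_loop E_non_edge[of p q k] E_sym[of k p q]
    by (cases "k = l") auto
  finally show ?thesis .
qed

sublocale Pbar: symmetric_stochastic Pbar
proof
  fix a b :: "'n \<times> 'm"
  obtain p k q l where ab: "a = (p, k)" "b = (q, l)" by (cases a, cases b)
  show "0 \<le> Pbar $ a $ b"
    unfolding ab Pbar_nth
    using gamma_degree[of k p] mult_nonneg_nonneg[OF less_imp_le[OF gamma_pos] E_nonneg[of k q p]]
    by (cases "p = q"; cases "k = l") simp_all
  show "Pbar $ a $ b = Pbar $ b $ a"
    unfolding ab Pbar_nth using E_sym[of k p q] by (cases "k = l"; cases "p = q") simp_all
  have "(\<Sum>b\<in>UNIV. Pbar $ a $ b) = (\<Sum>q\<in>UNIV. \<Sum>l\<in>UNIV. Pbar $ (p, k) $ (q, l))"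
    unfolding ab by (rule sum_pairs)
  also have "\<dots> = 1"
    by (simp add: Pbar_nth sum.distrib sum_distrib_left)
  finally show "(\<Sum>b\<in>UNIV. Pbar $ a $ b) = 1" .
qed

text \<open>Every expected edge gives a positive entry between its two agents in the same
  coordinate. Along paths, \<open>x\<close> is thus constant over the agents, so it lies in the
  consensus subspace and is orthogonal to itself.\<close>

lemma Pbar_gap: "\<exists>\<epsilon>. 0 < \<epsilon> \<and> \<epsilon> \<le> 1 \<and>
  (\<forall>x\<in>orthogonal_comp consensus_subspace. norm x = 1 \<longrightarrow> x \<bullet> (Pbar *v x) \<le> 1 - \<epsilon>)"
proof (rule Pbar.spectral_gap[OF subspace_orthogonal_comp])
  fix x assume x: "x \<in> orthogonal_comp consensus_subspace"
    and level: "\<And>a b. 0 < Pbar $ a $ b \<Longrightarrow> x $ a = x $ b"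
  have const: "x $ (j, k) = x $ (r, k)" for j r k
  proof -
    have "(j, r) \<in> (expected_edges M net i k)\<^sup>*"
      by (rule network[unfolded network_assumptions_def, THEN spec, THEN spec, THEN conjunct1,
        THEN spec, THEN spec])
    then show ?thesis
    proof (induction rule: rtrancl_induct)
      case (step q r)
      then have "0 < E k q r" by (simp add: expected_edges_def)
      moreover from this have "q \<noteq> r" using E_loop by auto
      ultimately have "0 < Pbar $ (r, k) $ (q, k)" using gamma_pos by (simp add: Pbar_nth)
      then have "x $ (r, k) = x $ (q, k)" by (rule level)
      then show ?case using step.IH by simp
    qed simp
  qed
  obtain r where "r \<in> (UNIV :: 'n set)" by blast
  have "x $ a = stack (\<lambda>_. \<chi> k. x $ (r, k)) $ a" for a
    using const[of "fst a" "snd a" r] unfolding stack_def vec_lambda_beta prod.collapse .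
  then have "x = stack (\<lambda>_. \<chi> k. x $ (r, k))" by (rule vec_eq_iff[THEN iffD2, OF allI])
  then have "x \<in> consensus_subspace"
    unfolding consensus_subspace_def by (intro CollectI exI conjI allI) (assumption, rule refl)
  then have "orthogonal x x" using x unfolding orthogonal_comp_def by blast
  then show "x = 0" by (simp only: orthogonal_self)
qed

text \<open>The all-ones vector is a consensus vector, so \<open>P\<close> fixes it almost surely
  and the quadratic form of the second moment at it is its squared norm.\<close>

lemma second_moment_ge_1: "1 \<le> spectral_norm (integral\<^sup>L M (\<lambda>\<omega>. transpose (P \<omega>) ** P \<omega>))"
proof (rule one_le_spectral_norm)
  let ?v = "(\<chi> a. 1) :: real^('n \<times> 'm)"
  have "?v $ a \<noteq> 0 $ a" for a by simp
  then show "?v \<noteq> 0" by metis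
  have PP: "integrable M (\<lambda>\<omega>. transpose (P \<omega>) ** P \<omega>)"
    by (rule integrable_transpose_mult) (rule P_moment)+
  \<comment> \<open>The quadratic form at a fixed vector is linear in the matrix, so it commutes
    with the expectation.\<close>
  have lin: "bounded_linear (\<lambda>S :: real^('n \<times> 'm)^('n \<times> 'm). ?v \<bullet> (S *v ?v))"
    unfolding linear_conv_bounded_linear[symmetric]
    by (rule linearI)
       (simp_all only: matrix_vector_mult_add_rdistrib inner_add_right
         scaleR_matrix_vector_assoc[symmetric] inner_scaleR_right real_scaleR_def)
  have "?v = stack (\<lambda>_. \<chi> k. 1)" by (simp add: vec_eq_iff stack_def)
  then have cons: "?v \<in> consensus_subspace" unfolding consensus_subspace_def by blast
  have "?v \<bullet> (integral\<^sup>L M (\<lambda>\<omega>. transpose (P \<omega>) ** P \<omega>) *v ?v) =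
    integral\<^sup>L M (\<lambda>\<omega>. ?v \<bullet> ((transpose (P \<omega>) ** P \<omega>) *v ?v))"
    by (rule integral_bounded_linear[OF lin PP, symmetric])
  also have "\<dots> = integral\<^sup>L M (\<lambda>\<omega>. (norm ?v)\<^sup>2)"
  proof (rule integral_cong_AE)
    show "(\<lambda>\<omega>. ?v \<bullet> ((transpose (P \<omega>) ** P \<omega>) *v ?v)) \<in> borel_measurable M"
      using integrable_bounded_linear[OF lin PP] by (rule borel_measurable_integrable)
    show "AE \<omega> in M. ?v \<bullet> ((transpose (P \<omega>) ** P \<omega>) *v ?v) = (norm ?v)\<^sup>2"
      using consensus_AE
    proof eventually_elim
      case (elim \<omega>)
      have "?v \<bullet> ((transpose (P \<omega>) ** P \<omega>) *v ?v) = ((P \<omega> *v ?v) v* P \<omega>) \<bullet> ?v"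
        unfolding matrix_vector_mul_assoc[symmetric] by (simp add: inner_commute)
      also have "\<dots> = (P \<omega> *v ?v) \<bullet> (P \<omega> *v ?v)" by (rule dot_lmul_matrix)
      also have "P \<omega> *v ?v = ?v" using elim cons by blast
      finally show ?case unfolding power2_norm_eq_inner .
    qed
  qed simp
  finally show "?v \<bullet> (integral\<^sup>L M (\<lambda>\<omega>. transpose (P \<omega>) ** P \<omega>) *v ?v) = (norm ?v)\<^sup>2"
    by (simp add: prob_space)
qed

lemma P_random_consensus: "\<exists>\<epsilon> \<delta>. 0 < \<epsilon> \<and> \<epsilon> \<le> 1 \<and> 0 \<le> \<delta> \<and> random_consensus_matrix M \<epsilon> \<delta> P"
proof -
  let ?s = "spectral_norm (integral\<^sup>L M (\<lambda>\<omega>. transpose (P \<omega>) ** P \<omega>))"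
  obtain \<epsilon> where \<epsilon>: "0 < \<epsilon>" "\<epsilon> \<le> 1"
    "\<forall>x\<in>orthogonal_comp consensus_subspace. norm x = 1 \<longrightarrow> x \<bullet> (Pbar *v x) \<le> 1 - \<epsilon>"
    using Pbar_gap by blast
  have "integrable M (\<lambda>\<omega>. transpose (P \<omega>) ** P \<omega>)"
    by (rule integrable_transpose_mult) (rule P_moment)+
  \<comment> \<open>The witness for \<delta> is the exact excess of the spectral norm over
    1.\<close>
  then have "random_consensus_matrix M \<epsilon> (?s - 1) P"
    unfolding random_consensus_matrix_def Let_def
    using \<epsilon> second_moment_ge_1 P_integrable consensus_AE Pbar.nonneg
    by (simp add: Pbar.spectral_norm_eq Pbar.spectral_radius_eq)
  then show ?thesis using \<epsilon> second_moment_ge_1 by (intro exI[of _ \<epsilon>] exI[of _ "?s - 1"]) simp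
qed

lemma n_square_integrable: "integrable M (\<lambda>\<omega>. n \<omega> \<bullet> n \<omega>)"
  unfolding inner_vec_def inner_real_def
  by (intro Bochner_Integration.integrable_sum integrable_mult_square_moment n_moment)

text \<open>Each quantity is its own bound; the content is that the expectations exist, which second
  moments of the entries of \<open>W\<close> and \<open>n\<close> guarantee.\<close>

lemma second_moments: "\<exists>a b c. 0 \<le> a \<and> 0 \<le> b \<and> 0 \<le> c \<and>
    integrable M (\<lambda>\<omega>. transpose (W \<omega>) ** W \<omega>) \<and>
    spectral_norm (integral\<^sup>L M (\<lambda>\<omega>. transpose (W \<omega>) ** W \<omega>)) \<le> a \<and>
    integrable M (\<lambda>\<omega>. n \<omega> \<bullet> n \<omega>) \<and> integral\<^sup>L M (\<lambda>\<omega>. n \<omega> \<bullet> n \<omega>) \<le> b \<and>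
    integrable M (\<lambda>\<omega>. transpose (W \<omega>) *v n \<omega>) \<and>
    norm (integral\<^sup>L M (\<lambda>\<omega>. transpose (W \<omega>) *v n \<omega>)) \<le> c"
proof (intro exI conjI)
  let ?b = "integral\<^sup>L M (\<lambda>\<omega>. n \<omega> \<bullet> n \<omega>)"
  show "0 \<le> spectral_norm (integral\<^sup>L M (\<lambda>\<omega>. transpose (W \<omega>) ** W \<omega>))" by (rule spectral_norm_nonneg)
  show "0 \<le> ?b" by simp
  show "0 \<le> norm (integral\<^sup>L M (\<lambda>\<omega>. transpose (W \<omega>) *v n \<omega>))" by (rule norm_ge_zero)
qed (rule order_refl n_square_integrable integrable_transpose_mult integrable_transpose_vector_mult
  W_moment n_moment)+

end

theorem proposition1:
  fixes M :: "'w measure" and net :: "('w, 'n::finite, 'm::finite) network"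
  assumes "prob_space M"
    and "protocol_assumptions M net"
    and "channel_assumptions M net"
    and "network_assumptions M net"
  shows "\<forall>i.
    (\<exists>\<epsilon>\<^sub>0 \<delta>\<^sub>0. 0 < \<epsilon>\<^sub>0 \<and> \<epsilon>\<^sub>0 \<le> 1 \<and> 0 \<le> \<delta>\<^sub>0 \<and>
       random_consensus_matrix M \<epsilon>\<^sub>0 \<delta>\<^sub>0 (P_check net i)) \<and>
    (has_bochner_integral M (W_check M net i) 0 \<and>
     has_bochner_integral M (n_check M net i) 0) \<and>
    (has_bochner_integral M (\<lambda>\<omega>. transpose (P_check net i \<omega>) ** W_check M net i \<omega>) 0 \<and>
     has_bochner_integral M (\<lambda>\<omega>. transpose (P_check net i \<omega>) *v n_check M net i \<omega>) 0) \<and>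
    (\<exists>a\<^sub>0 b\<^sub>0 c\<^sub>0. 0 \<le> a\<^sub>0 \<and> 0 \<le> b\<^sub>0 \<and> 0 \<le> c\<^sub>0 \<and>
       integrable M (\<lambda>\<omega>. transpose (W_check M net i \<omega>) ** W_check M net i \<omega>) \<and>
       spectral_norm (integral\<^sup>L M (\<lambda>\<omega>. transpose (W_check M net i \<omega>) ** W_check M net i \<omega>)) \<le> a\<^sub>0 \<and>
       integrable M (\<lambda>\<omega>. n_check M net i \<omega> \<bullet> n_check M net i \<omega>) \<and>
       integral\<^sup>L M (\<lambda>\<omega>. n_check M net i \<omega> \<bullet> n_check M net i \<omega>) \<le> b\<^sub>0 \<and>
       integrable M (\<lambda>\<omega>. transpose (W_check M net i \<omega>) *v n_check M net i \<omega>) \<and>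
       norm (integral\<^sup>L M (\<lambda>\<omega>. transpose (W_check M net i \<omega>) *v n_check M net i \<omega>)) \<le> c\<^sub>0)"
proof (intro allI conjI, goal_cases)
  have step: "ota_step M net"
    using assms by (simp add: ota_step_def ota_step_axioms_def)
  {
    case (1 i)
    show ?case by (rule ota_step.P_random_consensus[OF step])
  next
    case (2 i)
    show ?case by (rule ota_step.W_mean[OF step])
  next
    case (3 i)
    show ?case by (rule ota_step.n_mean[OF step])
  next
    case (4 i)
    show ?case by (rule ota_step.PW_mean[OF step])
  next
    case (5 i)
    show ?case by (rule ota_step.Pn_mean[OF step])
  next
    case (6 i)
    show ?case by (rule ota_step.second_moments[OF step])
  }
qed

end
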